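(* Let $\lambda\in(0,1)$ and $d\in(0,1-\lambda)$. For any $\delta\in(1-\lambda-d,1)$ and $a\in[0,1]$ such that $(\delta,a)\notin\mathcal{F}_1\cup\mathcal{F}_2$, there exist $\rho\in(0,1)$ and $\alpha\in[0,1]$ such that $$\delta\in[\delta(\rho^-,\alpha),\delta(\rho,\alpha)]\quad\text{and}\quad a\in[a(\delta,\rho^+,\alpha),a(\delta,\rho,\alpha)].$$ Consequently, if $\rho_f\in(0,1)$ is the rotation number of $f=f_{\delta,a}$, then there exists $\alpha\in[0,1]$ such that $$\delta\in[\delta(\rho_f^-,\alpha),\delta(\rho_f,\alpha)]\quad\text{and}\quad a\in[a(\delta,\rho_f^+,\alpha),a(\delta,\rho_f,\alpha)].$$ Moreover, $\alpha\in[0,1-\rho_f]$ if $(\delta,a)\in M_1$; $\alpha\in[1-\rho_f,1]$ if $(\delta,a)\in M_3$; and $\alpha=1-\rho_f$ if $(\delta,a)\in M_2$ and ($\rho_f\notin\mathbb{Q}$ or $a\notin\{\eta_1,\eta_2\}$).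
   Context: Notation: $\lfloor x\rfloor$ is the integer part and $\{x\}=x-\lfloor x\rfloor$ the fractional part of $x\in\mathbb{R}$. For $c\in\mathbb{R}$, $\theta_c(z)=0$ if $z<c$ and $\theta_c(z)=1$ if $z\ge c$. For $\delta,a\in[0,1]$, let $F:\mathbb{R}\to\mathbb{R}$, $F(x)=\lambda x+\delta+(1-\lambda)\lfloor x\rfloor+d\,\theta_a(\{x\})$, and let $f=f_{\delta,a}:[0,1)\to[0,1)$, $f(x)=F(x)\pmod1$. The rotation number of $f$ is $\rho_f=\lim_{n\to\infty}F^n(x)/n\pmod1$ (it exists and is independent of $x\in\mathbb{R}$). For $\rho,\alpha\in[0,1]$ define $$\delta(\rho,\alpha)=1-\lambda-d+\frac{1-\lambda}{\lambda}\sum_{k=1}^{\infty}\lambda^k\left((1-\lambda)\lfloor k\rho\rfloor+d\,\theta_{1-\alpha}(\{k\rho\})\right),$$ $$a(\delta,\rho,\alpha)=\frac{\delta}{1-\lambda}+\frac1\lambda\sum_{k=1}^{\infty}\lambda^k\left((1-\lambda)\lfloor\alpha-k\rho\rfloor+d\,\theta_\alpha(\{\alpha-k\rho\})\right)\quad\forall\delta\in[0,1].$$ For $\rho\in(0,1)$, $\delta(\rho^-,\alpha)=\lim_{r\to\rho^-}\delta(r,\alpha)$ and $a(\delta,\rho^+,\alpha)=\lim_{r\to\rho^+}a(\delta,r,\alpha)$. For given $\delta$ set $\eta_1=\frac{1-\delta-d}{\lambda}$, $\eta_2=\frac{1-\delta}{\lambda}$, and $M_1=\{(\delta,a):\delta\in(1-\lambda-d,1-d),\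 a\in[0,\eta_1)\}$, $M_2=\{(\delta,a):\delta\in(1-\lambda-d,1),\ a\in[0,1]\cap[\eta_1,\eta_2]\}$, $M_3=\{(\delta,a):\delta\in(1-\lambda,1),\ a\in(\eta_2,1]\}$. Also $\mathcal{F}_1=\{(\delta,a):\delta\in(1-\lambda-d,1-\lambda],\ a\in[\frac{\delta}{1-\lambda},1]\}$, $\mathcal{F}_2=\{(\delta,a):\delta\in[1-d,1),\ a\in[0,\frac{\delta+d-1}{1-\lambda}]\}$. *)

theory Defs
  imports "HOL-Analysis.Analysis"
begin

definition theta :: "real \<Rightarrow> real \<Rightarrow> real" where
  "theta c z = (if z < c then 0 else 1)"

text \<open>
  The parameters are ordered \<open>lam d delta a\<close> throughout. The map \<open>F\<close> is a lift of the circle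
  map \<open>f x = frac (F x)\<close> on \<open>{0..<1}\<close>.
\<close>

definition F :: "real \<Rightarrow> real \<Rightarrow> real \<Rightarrow> real \<Rightarrow> real \<Rightarrow> real" where
  "F lam d delta a x =
     lam * x + delta + (1 - lam) * of_int \<lfloor>x\<rfloor> + d * theta a (frac x)"

text \<open>
  The rotation number of \<open>f\<close>: the common limit of \<open>F^n(x)/n\<close> over all starting points \<open>x\<close>,
  taken modulo 1, with representative in \<open>{0..<1}\<close>.
\<close>

definition rotation_number :: "real \<Rightarrow> real \<Rightarrow> real \<Rightarrow> real \<Rightarrow> real" where
  "rotation_number lam d delta a =
     frac (THE L. \<forall>x. (\<lambda>n. (F lam d delta a ^^ n) x / real n) \<longlonglongrightarrow> L)"

text \<open>In the two series below the summation index is shifted, so that \<open>Suc k\<close> runs from 1.\<close>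

definition delta_fun :: "real \<Rightarrow> real \<Rightarrow> real \<Rightarrow> real \<Rightarrow> real" where
  "delta_fun lam d rho alpha =
     1 - lam - d + (1 - lam) / lam *
       (\<Sum>k. lam ^ Suc k *
          ((1 - lam) * of_int \<lfloor>real (Suc k) * rho\<rfloor>
            + d * theta (1 - alpha) (frac (real (Suc k) * rho))))"

definition a_fun :: "real \<Rightarrow> real \<Rightarrow> real \<Rightarrow> real \<Rightarrow> real \<Rightarrow> real" where
  "a_fun lam d delta rho alpha =
     delta / (1 - lam) + 1 / lam *
       (\<Sum>k. lam ^ Suc k *
          ((1 - lam) * of_int \<lfloor>alpha - real (Suc k) * rho\<rfloor>
            + d * theta alpha (frac (alpha - real (Suc k) * rho))))"

definition delta_fun_left :: "real \<Rightarrow> real \<Rightarrow> real \<Rightarrow> real \<Rightarrow> real" where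
  "delta_fun_left lam d rho alpha = Lim (at_left rho) (\<lambda>r. delta_fun lam d r alpha)"

definition a_fun_right :: "real \<Rightarrow> real \<Rightarrow> real \<Rightarrow> real \<Rightarrow> real \<Rightarrow> real" where
  "a_fun_right lam d delta rho alpha = Lim (at_right rho) (\<lambda>r. a_fun lam d delta r alpha)"

definition eta1 :: "real \<Rightarrow> real \<Rightarrow> real \<Rightarrow> real" where
  "eta1 lam d delta = (1 - delta - d) / lam"

definition eta2 :: "real \<Rightarrow> real \<Rightarrow> real" where
  "eta2 lam delta = (1 - delta) / lam"

definition M1 :: "real \<Rightarrow> real \<Rightarrow> (real \<times> real) set" where
  "M1 lam d = {(delta, a). delta \<in> {1 - lam - d<..<1 - d} \<and> a \<in> {0..<eta1 lam d delta}}"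

definition M2 :: "real \<Rightarrow> real \<Rightarrow> (real \<times> real) set" where
  "M2 lam d = {(delta, a). delta \<in> {1 - lam - d<..<1} \<and>
                 a \<in> {0..1} \<inter> {eta1 lam d delta..eta2 lam delta}}"

definition M3 :: "real \<Rightarrow> (real \<times> real) set" where
  "M3 lam = {(delta, a). delta \<in> {1 - lam<..<1} \<and> a \<in> {eta2 lam delta<..1}}"

definition F1 :: "real \<Rightarrow> real \<Rightarrow> (real \<times> real) set" where
  "F1 lam d = {(delta, a). delta \<in> {1 - lam - d<..1 - lam} \<and> a \<in> {delta / (1 - lam)..1}}"

definition F2 :: "real \<Rightarrow> real \<Rightarrow> (real \<times> real) set" where
  "F2 lam d = {(delta, a). delta \<in> {1 - d..<1} \<and> a \<in> {0..(delta + d - 1) / (1 - lam)}}"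

end

theory Submission
  imports Defs "HOL-Analysis.Kronecker_Approximation_Theorem" "HOL-Number_Theory.Cong"
begin

text \<open>
  Outside \<open>F1\<close> and \<open>F2\<close> the displacement of the lift \<open>T\<close> stays in a compact subinterval of
  \<open>(0, 1)\<close>, so the rotation number \<open>rho\<close> is its honest limit. The points \<open>(T ^^ n) (- m)\<close> are
  ordered on the line as their addresses \<open>n * rho - m\<close>, and \<open>alpha\<close> is the address at which the
  discontinuity \<open>a\<close> cuts this orbit. Since \<open>T\<close> contracts with rate \<open>lam\<close> apart from an additive
  term that depends only on the address, a point of the orbit with large \<open>n\<close> is nearly
  a power series in \<open>lam\<close> determined by its address. Approaching the addresses \<open>0\<close> and \<open>alpha\<close> from
  either side turns the four inequalities of the theorem into \<open>phi(0-) \<le> 0 \<le> phi(0)\<close> and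
  \<open>phi(alpha-) \<le> a \<le> phi(alpha)\<close>. For irrational \<open>rho\<close> the addresses are dense. For
  \<open>rho = p/q\<close> they lie on a grid, many points share an address, and as \<open>n\<close> grows they move
  monotonically; if the points with address \<open>0\<close> move below \<open>0\<close>, all addresses are shifted by \<open>1/q\<close>.
\<close>

section \<open>Orbits and the rotation number\<close>

text \<open>\<open>u (n * m)\<close> is within \<open>n + 1\<close> of \<open>n * u m\<close> and
  within \<open>m + 1\<close> of \<open>m * u n\<close>; comparing the two shows that the ratios
  form a Cauchy sequence.\<close>

lemma quasi_additive_ratio_convergent:
  fixes u :: "nat \<Rightarrow> real"
  assumes add: "\<And>m n. \<bar>u (m + n) - u m - u n\<bar> \<le> 1"
  shows "convergent (\<lambda>n. u n / real n)"
proof -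
  have mult: "\<bar>u (n * m) - real n * u m\<bar> \<le> real n + 1" for n m
  proof (induction n)
    case 0
    show ?case using add[of 0 0] by simp
  next
    case (Suc n)
    then show ?case using add[of m "n * m"] by (simp add: algebra_simps)
  qed
  have ratio: "\<bar>u m / real m - u n / real n\<bar> \<le> 2 / real m + 2 / real n"
    if "m > 0" "n > 0" for m n
  proof -
    have "\<bar>real n * u m - real m * u n\<bar> \<le> (real n + 1) + (real m + 1)"
      using mult[of n m] mult[of m n] by (simp add: mult.commute)
    also have "\<dots> \<le> 2 * real n + 2 * real m"
      using that by simp
    finally have "\<bar>real n * u m - real m * u n\<bar> / (real m * real n)
        \<le> (2 * real n + 2 * real m) / (real m * real n)"
      by (intro divide_right_mono) auto
    moreover have "\<bar>real n * u m - real m * u n\<bar> / (real m * real n)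
        = \<bar>u m / real m - u n / real n\<bar>"
    proof -
      have "u m / real m - u n / real n = (real n * u m - real m * u n) / (real m * real n)"
        using that by (simp add: field_simps)
      then show ?thesis by (simp add: abs_mult)
    qed
    moreover have "(2 * real n + 2 * real m) / (real m * real n) = 2 / real m + 2 / real n"
      using that by (simp add: field_simps)
    ultimately show ?thesis by simp
  qed
  have "Cauchy (\<lambda>n. u n / real n)"
  proof (rule CauchyI)
    fix e :: real assume "0 < e"
    obtain M :: nat where M: "4 / e < real M" using reals_Archimedean2 by blast
    have "0 < 4 / e" using \<open>0 < e\<close> by simp
    with M have "M > 0" by (metis of_nat_0_less_iff order_less_trans)
    show "\<exists>M. \<forall>m\<ge>M. \<forall>n\<ge>M. norm (u m / real m - u n / real n) < e"
    proof (intro exI allI impI)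
      fix m n assume mn: "M \<le> m" "M \<le> n"
      have small: "2 / real k < e / 2" if "M \<le> k" for k
      proof -
        have "4 / e < real k" using M that by simp
        then show ?thesis using \<open>0 < e\<close> \<open>M > 0\<close> that by (simp add: field_simps)
      qed
      show "norm (u m / real m - u n / real n) < e"
        using ratio[of m n] small[OF mn(1)] small[OF mn(2)] mn \<open>M > 0\<close> by simp
    qed
  qed
  then show ?thesis by (simp add: Cauchy_convergent_iff)
qed

section \<open>Monotonicity and displacement of the lift \<open>T\<close>\<close>

locale contracted_rotation =
  fixes lam d delta a :: real
  assumes lam: "0 < lam" "lam < 1"
    and d: "0 < d" "d < 1 - lam"
    and delta: "1 - lam - d < delta" "delta < 1"
    and a: "0 \<le> a" "a \<le> 1"
    and no_fixed_point: "(delta, a) \<notin> F1 lam d \<union> F2 lam d"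
begin

abbreviation T :: "real \<Rightarrow> real" where "T \<equiv> F lam d delta a"

text \<open>The piecewise constant part of \<open>T\<close>: it changes only at integers and at
  integer translates of \<open>a\<close>, so between points with equal itineraries \<open>T\<close>
  acts as a contraction by \<open>lam\<close>.\<close>

definition symb :: "real \<Rightarrow> real" where
  "symb x = (1 - lam) * of_int \<lfloor>x\<rfloor> + d * theta a (frac x)"

lemma T_eq: "T x = lam * x + delta + symb x"
  by (simp add: F_def symb_def)

lemma T_shift: "T (x + of_int m) = T x + of_int m"
  by (simp add: F_def frac_def algebra_simps)

text \<open>Both branches have slope \<open>lam\<close> and the jump \<open>d\<close> at
  \<open>a\<close> is upward; at an integer the value jumps by at least \<open>1 - lam - d\<close>,
  again upward.\<close>

lemma T_strict_mono: "strict_mono T"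
proof (rule strict_monoI)
  fix x y :: real assume "x < y"
  show "T x < T y"
  proof (cases "\<lfloor>x\<rfloor> = \<lfloor>y\<rfloor>")
    case True
    then have "theta a (frac x) \<le> theta a (frac y)"
      using \<open>x < y\<close> by (simp add: theta_def frac_def)
    then have "d * theta a (frac x) \<le> d * theta a (frac y)" using d by (simp add: mult_left_mono)
    moreover have "lam * x < lam * y" using lam \<open>x < y\<close> by simp
    ultimately show ?thesis using True by (simp add: F_def)
  next
    case False
    then have fl: "real_of_int \<lfloor>x\<rfloor> + 1 \<le> of_int \<lfloor>y\<rfloor>"
      using floor_mono[of x y] \<open>x < y\<close> by linarith
    have "lam * x < lam * (of_int \<lfloor>x\<rfloor> + 1)" using lam by simp
    moreover have "d * theta a (frac x) \<le> d" using d by (simp add: theta_def)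
    ultimately have "T x < of_int \<lfloor>x\<rfloor> + lam + delta + d"
      by (simp add: F_def algebra_simps)
    also have "\<dots> < of_int \<lfloor>y\<rfloor> + delta" using fl d by simp
    also have "\<dots> \<le> T y"
    proof -
      have "lam * of_int \<lfloor>y\<rfloor> \<le> lam * y" using lam by simp
      moreover have "0 \<le> d * theta a (frac y)" using d by (simp add: theta_def)
      ultimately show ?thesis by (simp add: F_def algebra_simps)
    qed
    finally show ?thesis .
  qed
qed

text \<open>\<open>T x - x\<close> depends only on \<open>frac x\<close> and decreases along each
  branch, so only its one-sided limits at \<open>0\<close>, \<open>a\<close> and \<open>1\<close>
  matter. In \<open>F1\<close> the left branch reaches the diagonal (perhaps only as a limit at
  \<open>a\<close>), in \<open>F2\<close> the right branch reaches the diagonal raised by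
  one.\<close>

lemma T_displacement:
  obtains eps where "0 < eps" "\<And>x. x + eps \<le> T x" "\<And>x. T x \<le> x + 1 - eps"
proof -
  \<comment> \<open>The first two entries bound the displacement from below on the left and the
    right branch (limits at \<open>a\<close> and \<open>1\<close>), the last two its distance to
    \<open>1\<close> (values at \<open>0\<close> and \<open>a\<close>).\<close>
  define eps where
    "eps = min (min (delta - (1 - lam) * a) (delta + d - (1 - lam)))
               (min (1 - delta) (1 - (delta + d - (1 - lam) * a)))"
  have disp: "T x - x = delta - (1 - lam) * frac x + d * theta a (frac x)" for x
    by (simp add: F_def frac_def algebra_simps)
  have "0 < delta - (1 - lam) * a"
  proof (cases "delta \<le> 1 - lam")
    case True
    then have "a < delta / (1 - lam)"
      using no_fixed_point delta a by (force simp: F1_def)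
    then show ?thesis using lam by (simp add: field_simps)
  next
    case False
    have "(1 - lam) * a \<le> 1 - lam" using a lam by (simp add: mult_left_le)
    with False show ?thesis by linarith
  qed
  moreover have "0 < 1 - (delta + d - (1 - lam) * a)"
  proof (cases "1 - d \<le> delta")
    case True
    then have "(delta + d - 1) / (1 - lam) < a"
      using no_fixed_point delta a by (force simp: F2_def)
    then show ?thesis using lam by (simp add: field_simps)
  next
    case False
    moreover have "0 \<le> (1 - lam) * a" using a lam by simp
    ultimately show ?thesis by linarith
  qed
  ultimately have pos: "0 < eps" using delta by (simp add: eps_def)
  have both: "eps \<le> T x - x \<and> T x - x \<le> 1 - eps" for x
  proof (cases "frac x < a")
    case True
    have "(1 - lam) * frac x \<le> (1 - lam) * a" using True lam by simp
    moreover have "0 \<le> (1 - lam) * frac x" using lam by simp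
    ultimately show ?thesis using True unfolding disp theta_def eps_def by simp linarith
  next
    case False
    have "(1 - lam) * a \<le> (1 - lam) * frac x" using False lam by simp
    moreover have "(1 - lam) * frac x \<le> 1 - lam"
      using lam frac_lt_1[of x] by (simp add: mult_left_le)
    ultimately show ?thesis using False unfolding disp theta_def eps_def by simp linarith
  qed
  show ?thesis
  proof (rule that[OF pos])
    fix x show "x + eps \<le> T x" "T x \<le> x + 1 - eps" using both[of x] by auto
  qed
qed

lemma T_ge: "x \<le> T x" and T_le: "T x \<le> x + 1"
proof -
  obtain eps where "0 < eps" "\<And>x. x + eps \<le> T x" "\<And>x. T x \<le> x + 1 - eps"
    by (rule T_displacement) blast
  note * = this
  show "x \<le> T x" using *(1) *(2)[of x] by linarith
  show "T x \<le> x + 1" using *(1) *(3)[of x] by linarith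
qed

section \<open>Iterates of \<open>T\<close> and existence of the rotation number\<close>

lemma iter_shift: "(T ^^ n) (x + of_int m) = (T ^^ n) x + of_int m"
  by (induction n) (simp_all add: T_shift)

lemma iter_neg_int: "(T ^^ n) (- of_int m) = (T ^^ n) 0 - of_int m"
  using iter_shift[of n 0 "- m"] by simp

lemma iter_strict_mono: "strict_mono (T ^^ n)"
  by (induction n) (use T_strict_mono in \<open>auto simp: strict_mono_def\<close>)

lemma iter_less_iff: "(T ^^ n) x < (T ^^ n) y \<longleftrightarrow> x < y"
  by (rule strict_mono_less[OF iter_strict_mono])

lemma iter_le_iff: "(T ^^ n) x \<le> (T ^^ n) y \<longleftrightarrow> x \<le> y"
  by (rule strict_mono_less_eq[OF iter_strict_mono])

lemma iter_ge: "x \<le> (T ^^ n) x" and iter_le: "(T ^^ n) x \<le> x + real n"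
proof -
  show "x \<le> (T ^^ n) x"
    by (induction n) (use T_ge order_trans in \<open>auto\<close>)
  show "(T ^^ n) x \<le> x + real n"
  proof (induction n)
    case (Suc n)
    then show ?case using T_le[of "(T ^^ n) x"] by simp
  qed simp
qed

text \<open>\<open>x\<close> lies between consecutive integers, and the images of these under
  \<open>T ^^ n\<close> are again one apart.\<close>

lemma iter_near: "\<bar>(T ^^ n) x - x - (T ^^ n) 0\<bar> \<le> 1"
proof -
  have "(T ^^ n) (of_int \<lfloor>x\<rfloor>) \<le> (T ^^ n) x" by (simp add: iter_le_iff)
  moreover have "(T ^^ n) x \<le> (T ^^ n) (of_int (\<lfloor>x\<rfloor> + 1))"
    unfolding iter_le_iff by linarith
  ultimately show ?thesis
    using iter_shift[of n 0 "\<lfloor>x\<rfloor>"] iter_shift[of n 0 "\<lfloor>x\<rfloor> + 1"]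
      floor_correct[of x] by (simp add: abs_le_iff) linarith
qed

text \<open>The orbit of \<open>0\<close> is quasi-additive by \<open>iter_near\<close>, which also
  makes the limit the same for every \<open>x\<close>. The uniqueness clause serves the definite
  description in \<open>rotation_number\<close>.\<close>

lemma rotation_limit:
  obtains L where "0 < L" "L < 1" "\<And>x. (\<lambda>n. (T ^^ n) x / real n) \<longlonglongrightarrow> L"
    "\<And>L'. \<forall>x. (\<lambda>n. (T ^^ n) x / real n) \<longlonglongrightarrow> L' \<Longrightarrow> L' = L"
proof -
  have "\<bar>(T ^^ (m + n)) 0 - (T ^^ m) 0 - (T ^^ n) 0\<bar> \<le> 1" for m n
    using iter_near[of m "(T ^^ n) 0"] by (simp add: funpow_add abs_minus_commute algebra_simps)
  then have "convergent (\<lambda>n. (T ^^ n) 0 / real n)"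
    by (rule quasi_additive_ratio_convergent)
  then obtain L where L: "(\<lambda>n. (T ^^ n) 0 / real n) \<longlonglongrightarrow> L"
    by (auto simp: convergent_def)
  have all: "(\<lambda>n. (T ^^ n) x / real n) \<longlonglongrightarrow> L" for x
  proof -
    have "(\<lambda>n. ((T ^^ n) x - (T ^^ n) 0) / real n) \<longlonglongrightarrow> 0"
    proof (rule Lim_null_comparison)
      show "\<forall>\<^sub>F n in sequentially. norm (((T ^^ n) x - (T ^^ n) 0) / real n) \<le> (\<bar>x\<bar> + 1) / real n"
      proof (rule always_eventually, rule allI)
        fix n
        have "\<bar>(T ^^ n) x - (T ^^ n) 0\<bar> \<le> \<bar>x\<bar> + 1" using iter_near[of n x] by linarith
        then show "norm (((T ^^ n) x - (T ^^ n) 0) / real n) \<le> (\<bar>x\<bar> + 1) / real n"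
          by (simp add: divide_right_mono)
      qed
      show "(\<lambda>n. (\<bar>x\<bar> + 1) / real n) \<longlonglongrightarrow> 0" by (rule lim_const_over_n)
    qed
    from tendsto_add[OF this L] show ?thesis by (simp add: diff_divide_distrib)
  qed
  obtain eps where eps: "0 < eps" "\<And>x. x + eps \<le> T x" "\<And>x. T x \<le> x + 1 - eps"
    by (rule T_displacement) blast
  have lin: "real n * eps \<le> (T ^^ n) 0 \<and> (T ^^ n) 0 \<le> real n * (1 - eps)" for n
  proof (induction n)
    case (Suc n)
    then show ?case using eps(2,3)[of "(T ^^ n) 0"] by (simp add: algebra_simps)
  qed simp
  have "eps \<le> L"
  proof (rule LIMSEQ_le_const[OF L], intro exI[of _ 1] allI impI)
    fix n :: nat assume "1 \<le> n"
    with lin[of n] show "eps \<le> (T ^^ n) 0 / real n" by (simp add: field_simps)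
  qed
  moreover have "L \<le> 1 - eps"
  proof (rule LIMSEQ_le_const2[OF L], intro exI[of _ 1] allI impI)
    fix n :: nat assume "1 \<le> n"
    with lin[of n] show "(T ^^ n) 0 / real n \<le> 1 - eps" by (simp add: field_simps)
  qed
  ultimately show ?thesis
    using that[of L] all eps(1) LIMSEQ_unique by (metis diff_less_eq less_add_same_cancel1
      order_le_less_trans order_less_le_trans)
qed

lemma iter_mult_le:
  assumes "(T ^^ q) 0 \<le> of_int p" shows "(T ^^ (j * q)) 0 \<le> of_int (int j * p)"
proof (induction j)
  case (Suc j)
  have "(T ^^ (Suc j * q)) 0 = (T ^^ q) ((T ^^ (j * q)) 0)" by (simp add: funpow_add)
  also have "\<dots> \<le> (T ^^ q) (0 + of_int (int j * p))" using Suc by (simp add: iter_le_iff)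
  also have "\<dots> \<le> of_int p + of_int (int j * p)"
    unfolding iter_shift using assms by simp
  finally show ?case by (simp add: algebra_simps)
qed simp

lemma iter_mult_ge:
  assumes "of_int p \<le> (T ^^ q) 0" shows "of_int (int j * p) \<le> (T ^^ (j * q)) 0"
proof (induction j)
  case (Suc j)
  have "of_int p + of_int (int j * p) \<le> (T ^^ q) (0 + of_int (int j * p))"
    unfolding iter_shift using assms by simp
  also have "\<dots> \<le> (T ^^ q) ((T ^^ (j * q)) 0)" using Suc by (simp add: iter_le_iff)
  also have "\<dots> = (T ^^ (Suc j * q)) 0" by (simp add: funpow_add)
  finally show ?case by (simp add: algebra_simps)
qed simp

end

section \<open>Orbit points are ordered as their addresses\<close>

locale contracted_rotation_number = contracted_rotation +
  fixes rho :: real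
  assumes rho_lim: "(\<lambda>n. (T ^^ n) 0 / real n) \<longlonglongrightarrow> rho"
    and rho: "0 < rho" "rho < 1"
begin

lemma rho_lim_mult:
  assumes "q > 0" shows "(\<lambda>j. (T ^^ (j * q)) 0 / real (j * q)) \<longlonglongrightarrow> rho"
proof -
  have "strict_mono (\<lambda>j. j * q)" using assms by (simp add: strict_mono_def)
  from LIMSEQ_subseq_LIMSEQ[OF rho_lim this] show ?thesis by (simp add: o_def)
qed

text \<open>The reversed inequality would propagate to all multiples of \<open>q\<close> by
  monotonicity and push the limit \<open>rho\<close> down to \<open>p / q\<close> or less.\<close>

lemma int_less_iter:
  assumes "of_int p < real q * rho" shows "of_int p < (T ^^ q) 0"
proof (cases "q = 0")
  case False
  show ?thesis
  proof (rule ccontr)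
    assume "\<not> of_int p < (T ^^ q) 0"
    then have *: "(T ^^ (j * q)) 0 \<le> of_int (int j * p)" for j by (intro iter_mult_le) simp
    have "rho \<le> of_int p / real q"
    proof (rule LIMSEQ_le_const2[OF rho_lim_mult])
      show "q > 0" using False by simp
      have "(T ^^ (j * q)) 0 / real (j * q) \<le> of_int p / real q" if "1 \<le> j" for j
        using *[of j] that False by (simp add: field_simps)
      then show "\<exists>N. \<forall>j\<ge>N. (T ^^ (j * q)) 0 / real (j * q) \<le> of_int p / real q" by blast
    qed
    with assms False show False by (simp add: field_simps)
  qed
qed (use assms in simp)

lemma iter_less_int:
  assumes "real q * rho < of_int p" shows "(T ^^ q) 0 < of_int p"
proof (cases "q = 0")
  case False
  show ?thesis
  proof (rule ccontr)
    assume "\<not> (T ^^ q) 0 < of_int p"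
    then have *: "of_int (int j * p) \<le> (T ^^ (j * q)) 0" for j by (intro iter_mult_ge) simp
    have "of_int p / real q \<le> rho"
    proof (rule LIMSEQ_le_const[OF rho_lim_mult])
      show "q > 0" using False by simp
      have "of_int p / real q \<le> (T ^^ (j * q)) 0 / real (j * q)" if "1 \<le> j" for j
        using *[of j] that False by (simp add: field_simps)
      then show "\<exists>N. \<forall>j\<ge>N. of_int p / real q \<le> (T ^^ (j * q)) 0 / real (j * q)" by blast
    qed
    with assms False show False by (simp add: field_simps)
  qed
qed (use assms in simp)

text \<open>Cancelling the common iterates, which preserve order, leaves one iterate of
  \<open>0\<close> to compare with an integer. Equal addresses stay undecided; the codings have to
  deal with them.\<close>

lemma iter_order:
  assumes "real n * rho - of_int m < real n' * rho - of_int m'"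
  shows "(T ^^ n) (- of_int m) < (T ^^ n') (- of_int m')"
proof (cases "n \<le> n'")
  case True
  then obtain k where k: "n' = n + k" using le_Suc_ex by blast
  have "of_int (m' - m) < (T ^^ k) 0"
    using assms by (intro int_less_iter) (simp add: k algebra_simps)
  then have "- of_int m < (T ^^ k) (- of_int m')"
    unfolding iter_neg_int by simp
  then have "(T ^^ n) (- of_int m) < (T ^^ n) ((T ^^ k) (- of_int m'))"
    unfolding iter_less_iff .
  then show ?thesis by (simp add: k funpow_add)
next
  case False
  then obtain k where k: "n = n' + k" using le_Suc_ex nat_le_linear by blast
  have "(T ^^ k) 0 < of_int (m - m')"
    using assms by (intro iter_less_int) (simp add: k algebra_simps)
  then have "(T ^^ k) (- of_int m) < - of_int m'"
    unfolding iter_neg_int by simp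
  then have "(T ^^ n') ((T ^^ k) (- of_int m)) < (T ^^ n') (- of_int m')"
    unfolding iter_less_iff .
  then show ?thesis by (simp add: k funpow_add)
qed

end

section \<open>Series and one-sided limits\<close>

lemma floor_left_limit: "\<forall>\<^sub>F t in at_left x. \<lfloor>t\<rfloor> = \<lceil>x::real\<rceil> - 1"
proof -
  have "\<forall>\<^sub>F t in at_left x. of_int (\<lceil>x\<rceil> - 1) < t"
    by (rule order_tendstoD(1)[OF tendsto_ident_at]) linarith
  moreover have "\<forall>\<^sub>F t in at_left x. t < x" by (simp add: eventually_at_filter)
  ultimately show ?thesis
  proof eventually_elim
    case (elim t)
    have "t < of_int \<lceil>x\<rceil>" using elim(2) by linarith
    with elim(1) show ?case by (intro floor_unique) auto
  qed
qed

lemma floor_right_limit: "\<forall>\<^sub>F t in at_right x. \<lfloor>t\<rfloor> = \<lfloor>x::real\<rfloor>"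
proof -
  have "\<forall>\<^sub>F t in at_right x. t < of_int (\<lfloor>x\<rfloor> + 1)"
    by (rule order_tendstoD(2)[OF tendsto_ident_at]) linarith
  moreover have "\<forall>\<^sub>F t in at_right x. x < t" by (simp add: eventually_at_filter)
  ultimately show ?thesis
  proof eventually_elim
    case (elim t)
    have "of_int \<lfloor>x\<rfloor> \<le> t" using elim(2) by linarith
    with elim(1) show ?case by (intro floor_unique) auto
  qed
qed

text \<open>Only floors remain on the right, and these have explicit one-sided limits.\<close>

lemma theta_frac: "theta c (frac u) = (if \<lfloor>u\<rfloor> \<le> \<lfloor>u - c\<rfloor> then 1 else 0)"
  by (simp add: theta_def frac_def le_floor_iff)

lemma theta_one_minus_frac: "theta (1 - c) (frac u) = (if \<lfloor>u\<rfloor> < \<lfloor>u + c\<rfloor> then 1 else 0)"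
proof -
  have "\<lfloor>u\<rfloor> < \<lfloor>u + c\<rfloor> \<longleftrightarrow> of_int (\<lfloor>u\<rfloor> + 1) \<le> u + c"
    by (simp only: le_floor_iff[symmetric]) linarith
  also have "\<dots> \<longleftrightarrow> 1 - c \<le> frac u" by (simp add: frac_def) linarith
  finally show ?thesis by (simp add: theta_def not_less[symmetric])
qed

lemma summable_power_linear:
  fixes x A B :: real
  assumes "0 < x" "x < 1"
  shows "summable (\<lambda>k. x ^ k * (A * real k + B))"
proof -
  have "summable (\<lambda>k. real k * x ^ k)"
  proof -
    \<comment> \<open>Term-by-term derivative of the geometric series.\<close>
    have "summable (\<lambda>n. diffs (\<lambda>_. 1::real) n * x ^ n)"
      by (rule termdiff_converges[of _ 1]) (use assms in \<open>auto intro: summable_geometric\<close>)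
    then have "summable (\<lambda>n. real (Suc n) * x ^ n)" by (simp add: diffs_def)
    then have "summable (\<lambda>n. real (Suc n) * x ^ n - x ^ n)"
      by (rule summable_diff) (use assms in \<open>auto intro: summable_geometric\<close>)
    then show ?thesis by (simp add: algebra_simps)
  qed
  then have "summable (\<lambda>k. A * (real k * x ^ k) + B * x ^ k)"
    by (intro summable_add summable_mult summable_geometric) (use assms in auto)
  then show ?thesis by (simp add: algebra_simps)
qed

lemma power_linear_tendsto_0:
  fixes x A B :: real
  assumes "0 < x" "x < 1"
  shows "(\<lambda>k. x ^ k * (A * real k + B)) \<longlonglongrightarrow> 0"
  by (rule summable_LIMSEQ_zero[OF summable_power_linear[OF assms]])

context contracted_rotation
begin

text \<open>The values of the symbol of a point with address \<open>u\<close>, for addresses approached from the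
  right and from the left; the discontinuity \<open>a\<close> has address \<open>alpha\<close>.\<close>

definition symb_right :: "real \<Rightarrow> real \<Rightarrow> real" where
  "symb_right alpha u = (1 - lam) * of_int \<lfloor>u\<rfloor> + (if \<lfloor>u\<rfloor> \<le> \<lfloor>u - alpha\<rfloor> then d else 0)"

definition symb_left :: "real \<Rightarrow> real \<Rightarrow> real" where
  "symb_left alpha u = (1 - lam) * (of_int \<lceil>u\<rceil> - 1) + (if \<lceil>u\<rceil> \<le> \<lceil>u - alpha\<rceil> then d else 0)"

text \<open>The position forced on a point with address \<open>y\<close> by unfolding
  \<open>T\<close> backwards forever; \<open>Suc k\<close> steps earlier the address was
  \<open>y - real (Suc k) * rho\<close>.\<close>

definition phi_right :: "real \<Rightarrow> real \<Rightarrow> real \<Rightarrow> real" where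
  "phi_right rho alpha y = (\<Sum>k. lam ^ k * (delta + symb_right alpha (y - real (Suc k) * rho)))"

definition phi_left :: "real \<Rightarrow> real \<Rightarrow> real \<Rightarrow> real" where
  "phi_left rho alpha y = (\<Sum>k. lam ^ k * (delta + symb_left alpha (y - real (Suc k) * rho)))"

lemma symb_right_bound: "\<bar>symb_right alpha u\<bar> \<le> \<bar>u\<bar> + 2"
proof -
  have "\<bar>(1 - lam) * real_of_int \<lfloor>u\<rfloor>\<bar> \<le> 1 * (\<bar>u\<bar> + 1)"
    unfolding abs_mult by (rule mult_mono) (use lam in \<open>simp_all, linarith\<close>)
  then show ?thesis using d lam unfolding symb_right_def by (simp split: if_split) linarith
qed

lemma symb_left_bound: "\<bar>symb_left alpha u\<bar> \<le> \<bar>u\<bar> + 2"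
proof -
  have "\<bar>(1 - lam) * (real_of_int \<lceil>u\<rceil> - 1)\<bar> \<le> 1 * (\<bar>u\<bar> + 1)"
    unfolding abs_mult by (rule mult_mono) (use lam in \<open>simp_all, linarith\<close>)
  then show ?thesis using d lam unfolding symb_left_def by (simp split: if_split) linarith
qed

lemma shift_bound:
  assumes "\<bar>r\<bar> \<le> 1" shows "\<bar>y - real (Suc k) * r\<bar> + c \<le> 1 * real k + (\<bar>y\<bar> + 1 + c)"
proof -
  have "\<bar>real (Suc k) * r\<bar> \<le> real (Suc k) * 1"
    unfolding abs_mult by (rule mult_mono) (use assms in auto)
  then show ?thesis by simp
qed

lemma series_summable:
  assumes "\<And>u. \<bar>s u\<bar> \<le> \<bar>u\<bar> + 2" "\<bar>r\<bar> \<le> 1"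
  shows "summable (\<lambda>k. lam ^ k * (s (y - real (Suc k) * r)))"
proof (rule summable_comparison_test'[OF summable_power_linear[OF lam]])
  fix n
  have "\<bar>s (y - real (Suc n) * r)\<bar> \<le> 1 * real n + (\<bar>y\<bar> + 1 + 2)"
    using assms(1)[of "y - real (Suc n) * r"] shift_bound[OF assms(2), of y n 2] by linarith
  then show "norm (lam ^ n * s (y - real (Suc n) * r)) \<le> lam ^ n * (1 * real n + (\<bar>y\<bar> + 1 + 2))"
    using lam by (simp add: abs_mult)
qed

lemma series_with_delta:
  assumes "\<And>u. \<bar>s u\<bar> \<le> \<bar>u\<bar> + 2" "\<bar>r\<bar> \<le> 1"
  shows "(\<lambda>k. lam ^ k * (delta + s (y - real (Suc k) * r))) sums
    (delta / (1 - lam) + (\<Sum>k. lam ^ k * s (y - real (Suc k) * r)))"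
proof -
  have "(\<lambda>k. delta * lam ^ k) sums (delta * (1 / (1 - lam)))"
    by (intro sums_mult geometric_sums) (use lam in auto)
  from sums_add[OF this summable_sums[OF series_summable[OF assms]]]
  show ?thesis by (simp add: algebra_simps)
qed

text \<open>Each step back contributes a factor \<open>lam\<close>, so the symbols of the last
  \<open>K\<close> steps determine the point up to a small remainder.\<close>

lemma iter_unfold:
  assumes "K \<le> n"
  shows "(T ^^ n) z = lam ^ K * (T ^^ (n - K)) z
    + (\<Sum>k<K. lam ^ k * (delta + symb ((T ^^ (n - Suc k)) z)))"
  using assms
proof (induction K)
  case (Suc K)
  then have "(T ^^ (n - K)) z = T ((T ^^ (n - Suc K)) z)"
    by (metis Suc_diff_Suc Suc_le_lessD comp_apply funpow.simps(2))
  then have "lam ^ K * (T ^^ (n - K)) z = lam ^ Suc K * (T ^^ (n - Suc K)) z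
      + lam ^ K * (delta + symb ((T ^^ (n - Suc K)) z))"
    by (simp only: T_eq) (simp add: algebra_simps)
  with Suc show ?case by simp
qed simp

section \<open>The four bounds of the theorem as values of \<open>phi_right\<close> and
  \<open>phi_left\<close>\<close>

lemma a_fun_eq:
  assumes "\<bar>r\<bar> \<le> 1" shows "a_fun lam d delta r alpha = phi_right r alpha alpha"
proof -
  have "(\<Sum>k. lam ^ Suc k * symb_right alpha (alpha - real (Suc k) * r))
      = lam * (\<Sum>k. lam ^ k * symb_right alpha (alpha - real (Suc k) * r))"
    using suminf_mult[OF series_summable[of "symb_right alpha", OF symb_right_bound assms]]
    by (simp add: mult.assoc)
  moreover have "(1 - lam) * of_int \<lfloor>u\<rfloor> + d * theta alpha (frac u) = symb_right alpha u" for u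
    by (simp add: symb_right_def theta_frac)
  ultimately show ?thesis
    using lam sums_unique[OF series_with_delta[of "symb_right alpha", OF symb_right_bound assms]]
    by (simp add: a_fun_def phi_right_def)
qed

text \<open>The reflection \<open>u = - v\<close> exchanges floors and ceilings; this is where the
  threshold \<open>1 - alpha\<close> in \<open>delta_fun\<close> comes from.\<close>

lemma symb_left_uminus:
  "symb_left alpha (- v) = d - (1 - lam)
    - ((1 - lam) * of_int \<lfloor>v\<rfloor> + d * theta (1 - alpha) (frac v))"
proof -
  have "\<lceil>- v\<rceil> = - \<lfloor>v\<rfloor>" "\<lceil>- v - alpha\<rceil> = - \<lfloor>v + alpha\<rfloor>"
    by (simp_all add: ceiling_def algebra_simps)
  then show ?thesis
    by (simp add: symb_left_def theta_one_minus_frac algebra_simps)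
qed

text \<open>The terms in \<open>delta\<close> cancel on the right. In this form
  \<open>delta \<le> delta_fun lam d r alpha\<close> says exactly that
  \<open>phi_left r alpha 0 \<le> 0\<close>.\<close>

lemma delta_fun_eq:
  assumes "\<bar>r\<bar> \<le> 1" shows "delta_fun lam d r alpha = delta - (1 - lam) * phi_left r alpha 0"
proof -
  let ?S = "\<lambda>v. (1 - lam) * of_int \<lfloor>v\<rfloor> + d * theta (1 - alpha) (frac v)"
  have S: "?S v = d - (1 - lam) - symb_left alpha (0 - v)" for v
    using symb_left_uminus[of alpha v] by simp
  have geo: "(\<lambda>k. (d - (1 - lam)) * lam ^ k) sums ((d - (1 - lam)) * (1 / (1 - lam)))"
    by (intro sums_mult geometric_sums) (use lam in auto)
  have sm: "summable (\<lambda>k. lam ^ k * symb_left alpha (0 - real (Suc k) * r))"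
    by (rule series_summable[OF symb_left_bound assms])
  have "(\<lambda>k. lam ^ Suc k * ?S (real (Suc k) * r)) sums
      (lam * ((d - (1 - lam)) * (1 / (1 - lam))
        - (\<Sum>k. lam ^ k * symb_left alpha (0 - real (Suc k) * r))))"
    using sums_mult[OF sums_diff[OF geo summable_sums[OF sm]], of lam]
    unfolding S by (simp add: algebra_simps)
  from sums_unique[OF this] have "delta_fun lam d r alpha = 1 - lam - d
      + (1 - lam) / lam * (lam * ((d - (1 - lam)) * (1 / (1 - lam))
        - (\<Sum>k. lam ^ k * symb_left alpha (0 - real (Suc k) * r))))"
    unfolding delta_fun_def by (simp only:)
  moreover have "phi_left r alpha 0 = delta / (1 - lam)
      + (\<Sum>k. lam ^ k * symb_left alpha (0 - real (Suc k) * r))"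
    unfolding phi_left_def
    by (rule sums_unique[symmetric, OF series_with_delta[OF symb_left_bound assms]])
  moreover have "(1 - lam) / lam * (lam * ((d - (1 - lam)) * (1 / (1 - lam)) - X))
      = d - (1 - lam) - (1 - lam) * X"
    "(1 - lam) * (delta / (1 - lam) + X) = delta + (1 - lam) * X" for X
    using lam by (simp_all add: field_simps)
  ultimately show ?thesis by simp
qed

text \<open>Every term is eventually constant in \<open>r\<close>, and a power of \<open>lam\<close>
  times a linear function dominates uniformly, so Tannery's theorem applies.\<close>

lemma series_tendsto:
  assumes bound: "\<And>u. \<bar>s u\<bar> \<le> \<bar>u\<bar> + 2"
    and small: "\<forall>\<^sub>F r in G. \<bar>r\<bar> \<le> 1" and "G \<noteq> bot"
    and step: "\<And>k. \<forall>\<^sub>F r in G. s (y - real (Suc k) * r) = s' (y - real (Suc k) * rho)"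
  shows "((\<lambda>r. \<Sum>k. lam ^ k * (delta + s (y - real (Suc k) * r)))
    \<longlongrightarrow> (\<Sum>k. lam ^ k * (delta + s' (y - real (Suc k) * rho)))) G"
proof (rule tannerys_theorem[THEN conjunct2, THEN conjunct2])
  fix k
  show "((\<lambda>r. lam ^ k * (delta + s (y - real (Suc k) * r)))
      \<longlongrightarrow> lam ^ k * (delta + s' (y - real (Suc k) * rho))) G"
    by (rule tendsto_eventually, rule eventually_mono[OF step[of k]]) (simp only:)
next
  let ?M = "\<lambda>k. lam ^ k * (1 * real k + (\<bar>y\<bar> + 1 + (2 + \<bar>delta\<bar>)))"
  show "summable ?M" by (rule summable_power_linear[OF lam])
  have "\<forall>\<^sub>F x in at_top \<times>\<^sub>F G. True \<and> \<bar>snd x\<bar> \<le> 1"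
    by (rule eventually_prodI[OF _ small]) simp
  then show "\<forall>\<^sub>F (k, r) in at_top \<times>\<^sub>F G.
      norm (lam ^ k * (delta + s (y - real (Suc k) * r))) \<le> ?M k"
  proof eventually_elim
    case (elim x)
    obtain k r where x: "x = (k, r)" by (cases x)
    have "\<bar>delta + s (y - real (Suc k) * r)\<bar> \<le> 1 * real k + (\<bar>y\<bar> + 1 + (2 + \<bar>delta\<bar>))"
    proof -
      have "\<bar>r\<bar> \<le> 1" using elim x by simp
      from shift_bound[OF this, of y k "2 + \<bar>delta\<bar>"] bound[of "y - real (Suc k) * r"]
      show ?thesis by linarith
    qed
    then show ?case using lam x by (simp add: abs_mult)
  qed
qed (rule \<open>G \<noteq> bot\<close>)

text \<open>As \<open>r\<close> decreases to \<open>rho\<close>, the addresses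
  \<open>alpha - real (Suc k) * r\<close> increase to their limits, so all floors tend to left
  limits and \<open>symb_right\<close> turns into \<open>symb_left\<close>.\<close>

lemma a_fun_right_eq:
  assumes "0 < rho" "rho < 1"
  shows "a_fun_right lam d delta rho alpha = phi_left rho alpha alpha"
proof -
  have small: "\<forall>\<^sub>F r in at_right rho. \<bar>r\<bar> \<le> 1"
  proof -
    have "\<forall>\<^sub>F r in at_right rho. r < 1"
      by (rule order_tendstoD(2)[OF tendsto_ident_at assms(2)])
    moreover have "\<forall>\<^sub>F r in at_right rho. rho < r" by (simp add: eventually_at_filter)
    ultimately show ?thesis by eventually_elim (use assms in auto)
  qed
  have "((\<lambda>r. phi_right r alpha alpha) \<longlongrightarrow> phi_left rho alpha alpha) (at_right rho)"
    unfolding phi_left_def phi_right_def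
  proof (rule series_tendsto[OF symb_right_bound small])
    fix k
    let ?u = "alpha - real (Suc k) * rho"
    have lim: "filterlim (\<lambda>r. alpha - c - real (Suc k) * r) (at_left (?u - c)) (at_right rho)" for c
      unfolding filterlim_at
    proof
      have "((\<lambda>r. alpha - c - real (Suc k) * r) \<longlongrightarrow> alpha - c - real (Suc k) * rho) (at_right rho)"
        by (intro tendsto_intros)
      moreover have "alpha - c - real (Suc k) * rho = ?u - c" by simp
      ultimately show "((\<lambda>r. alpha - c - real (Suc k) * r) \<longlongrightarrow> ?u - c) (at_right rho)"
        by (simp only:)
      show "\<forall>\<^sub>F r in at_right rho. alpha - c - real (Suc k) * r \<in> {..<?u - c} \<and>
          alpha - c - real (Suc k) * r \<noteq> ?u - c"
      proof -
        have "\<forall>\<^sub>F r in at_right rho. rho < r" by (simp add: eventually_at_filter)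
        then show ?thesis
        proof eventually_elim
          case (elim r)
          then have "real (Suc k) * rho < real (Suc k) * r" by simp
          then show ?case by simp
        qed
      qed
    qed
    have "\<forall>\<^sub>F r in at_right rho. \<lfloor>alpha - real (Suc k) * r\<rfloor> = \<lceil>?u\<rceil> - 1"
      using eventually_compose_filterlim[OF floor_left_limit lim[of 0]] by simp
    moreover have "\<forall>\<^sub>F r in at_right rho. \<lfloor>alpha - real (Suc k) * r - alpha\<rfloor> = \<lceil>?u - alpha\<rceil> - 1"
      using eventually_compose_filterlim[OF floor_left_limit lim[of alpha]] by simp
    ultimately show "\<forall>\<^sub>F r in at_right rho.
        symb_right alpha (alpha - real (Suc k) * r) = symb_left alpha ?u"
    proof eventually_elim
      case (elim r)
      show ?case by (simp only: symb_right_def symb_left_def elim) simp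
    qed
  qed simp
  moreover have "\<forall>\<^sub>F r in at_right rho. phi_right r alpha alpha = a_fun lam d delta r alpha"
    using small by eventually_elim (simp add: a_fun_eq)
  ultimately have "((\<lambda>r. a_fun lam d delta r alpha) \<longlongrightarrow> phi_left rho alpha alpha) (at_right rho)"
    by (rule Lim_transform_eventually)
  then show ?thesis by (simp add: a_fun_right_def tendsto_Lim)
qed

text \<open>As \<open>r\<close> increases to \<open>rho\<close>, the addresses
  \<open>0 - real (Suc k) * r\<close> decrease to their limits, where each ceiling becomes a floor
  plus one; so \<open>symb_left\<close> turns into \<open>symb_right\<close>.\<close>

lemma delta_fun_left_eq:
  assumes "0 < rho" "rho < 1"
  shows "delta_fun_left lam d rho alpha = delta - (1 - lam) * phi_right rho alpha 0"
proof -
  have small: "\<forall>\<^sub>F r in at_left rho. \<bar>r\<bar> \<le> 1"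
  proof -
    have "\<forall>\<^sub>F r in at_left rho. 0 < r"
      by (rule order_tendstoD(1)[OF tendsto_ident_at assms(1)])
    moreover have "\<forall>\<^sub>F r in at_left rho. r < rho" by (simp add: eventually_at_filter)
    ultimately show ?thesis by eventually_elim (use assms in auto)
  qed
  have "((\<lambda>r. phi_left r alpha 0) \<longlongrightarrow> phi_right rho alpha 0) (at_left rho)"
    unfolding phi_left_def phi_right_def
  proof (rule series_tendsto[OF symb_left_bound small])
    fix k
    let ?v = "real (Suc k) * rho"
    have lim: "filterlim (\<lambda>r. real (Suc k) * r + c) (at_left (?v + c)) (at_left rho)" for c
      unfolding filterlim_at
    proof
      show "((\<lambda>r. real (Suc k) * r + c) \<longlongrightarrow> ?v + c) (at_left rho)"
        by (intro tendsto_intros)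
      show "\<forall>\<^sub>F r in at_left rho. real (Suc k) * r + c \<in> {..<?v + c} \<and>
          real (Suc k) * r + c \<noteq> ?v + c"
      proof -
        have "\<forall>\<^sub>F r in at_left rho. r < rho" by (simp add: eventually_at_filter)
        then show ?thesis
        proof eventually_elim
          case (elim r)
          then have "real (Suc k) * r < real (Suc k) * rho" by simp
          then show ?case by simp
        qed
      qed
    qed
    have "\<forall>\<^sub>F r in at_left rho. \<lfloor>real (Suc k) * r\<rfloor> = \<lceil>?v\<rceil> - 1"
      using eventually_compose_filterlim[OF floor_left_limit lim[of 0]] by simp
    moreover have "\<forall>\<^sub>F r in at_left rho. \<lfloor>real (Suc k) * r + alpha\<rfloor> = \<lceil>?v + alpha\<rceil> - 1"
      using eventually_compose_filterlim[OF floor_left_limit lim[of alpha]] by simp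
    ultimately show "\<forall>\<^sub>F r in at_left rho.
        symb_left alpha (0 - real (Suc k) * r) = symb_right alpha (0 - ?v)"
    proof eventually_elim
      case (elim r)
      have neg: "\<lceil>0 - w\<rceil> = - \<lfloor>w\<rfloor>" "\<lceil>0 - w - alpha\<rceil> = - \<lfloor>w + alpha\<rfloor>"
        "\<lfloor>0 - w\<rfloor> = - \<lceil>w\<rceil>" "\<lfloor>0 - w - alpha\<rfloor> = - \<lceil>w + alpha\<rceil>" for w
      proof -
        have "0 - w - alpha = - (w + alpha)" by simp
        then show "\<lceil>0 - w\<rceil> = - \<lfloor>w\<rfloor>" "\<lceil>0 - w - alpha\<rceil> = - \<lfloor>w + alpha\<rfloor>"
          "\<lfloor>0 - w\<rfloor> = - \<lceil>w\<rceil>" "\<lfloor>0 - w - alpha\<rfloor> = - \<lceil>w + alpha\<rceil>"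
          by (simp_all only: ceiling_def minus_minus diff_0)
      qed
      have "\<lceil>0 - real (Suc k) * r\<rceil> = \<lfloor>0 - ?v\<rfloor> + 1"
        "\<lceil>0 - real (Suc k) * r - alpha\<rceil> = \<lfloor>0 - ?v - alpha\<rfloor> + 1"
        unfolding neg using elim by simp_all
      then show ?case unfolding symb_right_def symb_left_def by (simp only:) simp
    qed
  qed simp
  then have "((\<lambda>r. delta - (1 - lam) * phi_left r alpha 0)
      \<longlongrightarrow> delta - (1 - lam) * phi_right rho alpha 0) (at_left rho)"
    by (intro tendsto_intros)
  moreover have "\<forall>\<^sub>F r in at_left rho. delta - (1 - lam) * phi_left r alpha 0 = delta_fun lam d r alpha"
    using small by eventually_elim (simp add: delta_fun_eq)
  ultimately have "((\<lambda>r. delta_fun lam d r alpha)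
      \<longlongrightarrow> delta - (1 - lam) * phi_right rho alpha 0) (at_left rho)"
    by (rule Lim_transform_eventually)
  then show ?thesis by (simp add: delta_fun_left_def tendsto_Lim)
qed

section \<open>Comparing the series with orbit points\<close>

lemma symb_floor:
  "symb x = (1 - lam) * of_int \<lfloor>x\<rfloor> + (if \<lfloor>x\<rfloor> \<le> \<lfloor>x - a\<rfloor> then d else 0)"
  by (simp add: symb_def theta_frac)

lemma iter_diff_bounds:
  assumes "K \<le> n"
  shows "(T ^^ n) z - real K \<le> (T ^^ (n - K)) z" "(T ^^ (n - K)) z \<le> (T ^^ n) z"
proof -
  have "(T ^^ n) z = (T ^^ K) ((T ^^ (n - K)) z)"
    using assms by (metis comp_apply funpow_add le_add_diff_inverse)
  then show "(T ^^ n) z - real K \<le> (T ^^ (n - K)) z" "(T ^^ (n - K)) z \<le> (T ^^ n) z"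
    using iter_ge[of "(T ^^ (n - K)) z" K] iter_le[of K "(T ^^ (n - K)) z"] by simp_all
qed

lemma series_partial_sums:
  assumes "\<And>u. \<bar>s u\<bar> \<le> \<bar>u\<bar> + 2" "\<bar>r\<bar> \<le> 1"
  shows "(\<lambda>K. \<Sum>k<K. lam ^ k * (delta + s (y - real (Suc k) * r)))
    \<longlonglongrightarrow> (\<Sum>k. lam ^ k * (delta + s (y - real (Suc k) * r)))"
  using summable_sums[OF sums_summable[OF series_with_delta[of s, OF assms]]] by (simp add: sums_def)

text \<open>An orbit point above \<open>c\<close>, unfolded by \<open>K\<close> steps, is a partial
  sum plus at most \<open>lam ^ K * C\<close>, which vanishes in the limit. Point and time may vary
  with \<open>K\<close>.\<close>

lemma series_ge:
  assumes s: "\<And>u. \<bar>s u\<bar> \<le> \<bar>u\<bar> + 2" "\<bar>r\<bar> \<le> 1"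
    and orbit: "\<And>K. \<exists>n z. K \<le> n \<and> (\<forall>k<K. symb ((T ^^ (n - Suc k)) z) = s (y - real (Suc k) * r))
      \<and> c \<le> (T ^^ n) z \<and> (T ^^ n) z \<le> C"
  shows "c \<le> (\<Sum>k. lam ^ k * (delta + s (y - real (Suc k) * r)))"
proof (rule LIMSEQ_le[OF _ series_partial_sums[of s, OF s]])
  show "(\<lambda>K. c - lam ^ K * (0 * real K + C)) \<longlonglongrightarrow> c"
    using tendsto_diff[OF tendsto_const[of c] power_linear_tendsto_0[OF lam, of "0" C]]
    by (simp only: diff_0_right)
  have "c - lam ^ K * (0 * real K + C) \<le> (\<Sum>k<K. lam ^ k * (delta + s (y - real (Suc k) * r)))" for K
  proof -
    obtain n z where n: "K \<le> n" and sy: "\<forall>k<K. symb ((T ^^ (n - Suc k)) z) = s (y - real (Suc k) * r)"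
      and z: "c \<le> (T ^^ n) z" "(T ^^ n) z \<le> C" using orbit by blast
    have "(T ^^ n) z = lam ^ K * (T ^^ (n - K)) z
        + (\<Sum>k<K. lam ^ k * (delta + s (y - real (Suc k) * r)))"
      unfolding iter_unfold[OF n, of z] using sy by simp
    moreover have "lam ^ K * (T ^^ (n - K)) z \<le> lam ^ K * C"
      using iter_diff_bounds(2)[OF n, of z] z lam by (intro mult_left_mono) auto
    ultimately show ?thesis using z by simp
  qed
  then show "\<exists>N. \<forall>K\<ge>N. c - lam ^ K * (0 * real K + C)
      \<le> (\<Sum>k<K. lam ^ k * (delta + s (y - real (Suc k) * r)))" by blast
qed

lemma series_le:
  assumes s: "\<And>u. \<bar>s u\<bar> \<le> \<bar>u\<bar> + 2" "\<bar>r\<bar> \<le> 1"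
    and orbit: "\<And>K. \<exists>n z. K \<le> n \<and> (\<forall>k<K. symb ((T ^^ (n - Suc k)) z) = s (y - real (Suc k) * r))
      \<and> (T ^^ n) z \<le> c \<and> C \<le> (T ^^ n) z"
  shows "(\<Sum>k. lam ^ k * (delta + s (y - real (Suc k) * r))) \<le> c"
proof (rule LIMSEQ_le[OF series_partial_sums[of s, OF s]])
  \<comment> \<open>Going back \<open>K\<close> steps can lower a point by \<open>K\<close>, hence
    the linear term; an upper bound as in \<open>series_ge\<close> passes to earlier points
    unchanged.\<close>
  show "(\<lambda>K. c - lam ^ K * (- 1 * real K + C)) \<longlonglongrightarrow> c"
    using tendsto_diff[OF tendsto_const[of c] power_linear_tendsto_0[OF lam, of "- 1" C]]
    by (simp only: diff_0_right)
  have "(\<Sum>k<K. lam ^ k * (delta + s (y - real (Suc k) * r))) \<le> c - lam ^ K * (- 1 * real K + C)" for K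
  proof -
    obtain n z where n: "K \<le> n" and sy: "\<forall>k<K. symb ((T ^^ (n - Suc k)) z) = s (y - real (Suc k) * r)"
      and z: "(T ^^ n) z \<le> c" "C \<le> (T ^^ n) z" using orbit by blast
    have "(T ^^ n) z = lam ^ K * (T ^^ (n - K)) z
        + (\<Sum>k<K. lam ^ k * (delta + s (y - real (Suc k) * r)))"
      unfolding iter_unfold[OF n, of z] using sy by simp
    moreover have "lam ^ K * (- 1 * real K + C) \<le> lam ^ K * (T ^^ (n - K)) z"
      using iter_diff_bounds(1)[OF n, of z] z lam by (intro mult_left_mono) auto
    ultimately show ?thesis using z by linarith
  qed
  then show "\<exists>N. \<forall>K\<ge>N. (\<Sum>k<K. lam ^ k * (delta + s (y - real (Suc k) * r)))
      \<le> c - lam ^ K * (- 1 * real K + C)" by blast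
qed

end

section \<open>Codings\<close>

text \<open>A coding assigns to \<open>(T ^^ n) (- m)\<close> the address \<open>n * rho - m - e\<close>, such that beyond time
  \<open>N\<close> the discontinuities \<open>0\<close> and \<open>a\<close> of \<open>T\<close> are separated exactly by the addresses
  \<open>0\<close> and \<open>alpha\<close>. The last two conditions say that \<open>0\<close> and \<open>alpha\<close> are approximated from both
  sides by addresses, as far as the itinerary of the last \<open>K\<close> steps is concerned.\<close>

locale rotation_coding = contracted_rotation_number +
  fixes e alpha :: real and N :: nat
  assumes zero_code: "\<And>n m. N \<le> n \<Longrightarrow>
      0 \<le> (T ^^ n) (- of_int m) \<longleftrightarrow> 0 \<le> real n * rho - of_int m - e"
    and a_code: "\<And>n m. N \<le> n \<Longrightarrow>
      a \<le> (T ^^ n) (- of_int m) \<longleftrightarrow> alpha \<le> real n * rho - of_int m - e"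
    and approx_right: "\<And>y K. y \<in> {0, alpha} \<Longrightarrow> \<exists>n m. N + K \<le> n \<and> (\<forall>k\<le>K. \<forall>c\<in>{0, alpha}.
      \<lfloor>real n * rho - of_int m - e - real k * rho - c\<rfloor> = \<lfloor>y - real k * rho - c\<rfloor>)"
    and approx_left: "\<And>y K. y \<in> {0, alpha} \<Longrightarrow> \<exists>n m. N + K \<le> n \<and> (\<forall>k\<le>K. \<forall>c\<in>{0, alpha}.
      \<lfloor>real n * rho - of_int m - e - real k * rho - c\<rfloor> = \<lceil>y - real k * rho - c\<rceil> - 1)"
begin

text \<open>Replacing \<open>m\<close> by \<open>m + l\<close> carries the separation at
  \<open>0\<close> and \<open>a\<close> to all integer translates, and the integers below a real
  determine its floor.\<close>

lemma floor_code:
  assumes "N \<le> n" "(c, b) \<in> {(0, 0), (alpha, a)}"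
  shows "\<lfloor>(T ^^ n) (- of_int m) - b\<rfloor> = \<lfloor>real n * rho - of_int m - e - c\<rfloor>"
proof -
  have "of_int l \<le> (T ^^ n) (- of_int m) - b \<longleftrightarrow> of_int l \<le> real n * rho - of_int m - e - c" for l
  proof -
    have "b \<le> (T ^^ n) (- of_int (m + l)) \<longleftrightarrow> c \<le> real n * rho - of_int (m + l) - e"
      using assms zero_code[of n "m + l"] a_code[of n "m + l"] by auto
    then show ?thesis unfolding iter_neg_int by auto
  qed
  then show ?thesis by (metis le_floor_iff order_antisym_conv order_refl)
qed

lemma symb_code:
  assumes "N \<le> n"
  shows "symb ((T ^^ n) (- of_int m)) = symb_right alpha (real n * rho - of_int m - e)"
  using floor_code[OF assms, of 0 0 m] floor_code[OF assms, of alpha a m]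
  by (simp add: symb_floor symb_right_def)

text \<open>The addresses from \<open>approx_right\<close> share the floors of \<open>y\<close>
  along the last \<open>K\<close> steps, hence its right symbols, so \<open>series_ge\<close>
  applies.\<close>

lemma phi_right_ge:
  assumes y: "(y, b) \<in> {(0, 0), (alpha, a)}" shows "b \<le> phi_right rho alpha y"
  unfolding phi_right_def
proof (rule series_ge[OF symb_right_bound])
  show "\<bar>rho\<bar> \<le> 1" using rho by simp
  fix K
  have "y \<in> {0, alpha}" using y by auto
  from approx_right[OF this, of K] obtain n m where n: "N + K \<le> n"
    and fl: "\<forall>k\<le>K. \<forall>c\<in>{0, alpha}. \<lfloor>real n * rho - of_int m - e - real k * rho - c\<rfloor>
      = \<lfloor>y - real k * rho - c\<rfloor>" by blast
  let ?z = "- real_of_int m"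
  have "symb ((T ^^ (n - Suc k)) ?z) = symb_right alpha (y - real (Suc k) * rho)" if "k < K" for k
  proof -
    have key: "real (n - Suc k) * rho - of_int m - e = real n * rho - of_int m - e - real (Suc k) * rho"
      using n that by (simp add: of_nat_diff left_diff_distrib)
    have "symb ((T ^^ (n - Suc k)) ?z) = symb_right alpha (real (n - Suc k) * rho - of_int m - e)"
      using n that by (intro symb_code) simp
    then show ?thesis unfolding key symb_right_def
      using fl[rule_format, of "Suc k" 0] fl[rule_format, of "Suc k" alpha] that by simp
  qed
  \<comment> \<open>Taking \<open>k = 0\<close> and \<open>c = y\<close> puts the address into
    \<open>[y, y + 1)\<close>, hence the point into \<open>[b, b + 1)\<close>.\<close>
  moreover have "\<lfloor>(T ^^ n) ?z - b\<rfloor> = 0"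
  proof -
    have "\<lfloor>(T ^^ n) ?z - b\<rfloor> = \<lfloor>real n * rho - of_int m - e - y\<rfloor>"
      using n y by (intro floor_code) simp_all
    then show ?thesis using fl[rule_format, of 0 y] y by auto
  qed
  then have "b \<le> (T ^^ n) ?z \<and> (T ^^ n) ?z \<le> b + 1" by linarith
  ultimately show "\<exists>n z. K \<le> n \<and>
      (\<forall>k<K. symb ((T ^^ (n - Suc k)) z) = symb_right alpha (y - real (Suc k) * rho)) \<and>
      b \<le> (T ^^ n) z \<and> (T ^^ n) z \<le> b + 1"
    using n by (intro exI[of _ n] exI[of _ ?z]) simp
qed

lemma phi_left_le:
  assumes y: "(y, b) \<in> {(0, 0), (alpha, a)}" shows "phi_left rho alpha y \<le> b"
  unfolding phi_left_def
proof (rule series_le[OF symb_left_bound])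
  show "\<bar>rho\<bar> \<le> 1" using rho by simp
  fix K
  have "y \<in> {0, alpha}" using y by auto
  from approx_left[OF this, of K] obtain n m where n: "N + K \<le> n"
    and fl: "\<forall>k\<le>K. \<forall>c\<in>{0, alpha}. \<lfloor>real n * rho - of_int m - e - real k * rho - c\<rfloor>
      = \<lceil>y - real k * rho - c\<rceil> - 1" by blast
  let ?z = "- real_of_int m"
  have "symb ((T ^^ (n - Suc k)) ?z) = symb_left alpha (y - real (Suc k) * rho)" if "k < K" for k
  proof -
    have key: "real (n - Suc k) * rho - of_int m - e = real n * rho - of_int m - e - real (Suc k) * rho"
      using n that by (simp add: of_nat_diff left_diff_distrib)
    have "symb ((T ^^ (n - Suc k)) ?z) = symb_right alpha (real (n - Suc k) * rho - of_int m - e)"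
      using n that by (intro symb_code) simp
    then show ?thesis unfolding key symb_right_def symb_left_def
      using fl[rule_format, of "Suc k" 0] fl[rule_format, of "Suc k" alpha] that by simp
  qed
  moreover have "\<lfloor>(T ^^ n) ?z - b\<rfloor> = - 1"
  proof -
    have "\<lfloor>(T ^^ n) ?z - b\<rfloor> = \<lfloor>real n * rho - of_int m - e - y\<rfloor>"
      using n y by (intro floor_code) simp_all
    then show ?thesis using fl[rule_format, of 0 y] y by auto
  qed
  then have "(T ^^ n) ?z \<le> b \<and> b - 1 \<le> (T ^^ n) ?z" by linarith
  ultimately show "\<exists>n z. K \<le> n \<and>
      (\<forall>k<K. symb ((T ^^ (n - Suc k)) z) = symb_left alpha (y - real (Suc k) * rho)) \<and>
      (T ^^ n) z \<le> b \<and> b - 1 \<le> (T ^^ n) z"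
    using n by (intro exI[of _ n] exI[of _ ?z]) simp
qed

lemma delta_range: "delta \<in> {delta_fun_left lam d rho alpha..delta_fun lam d rho alpha}"
  using phi_right_ge[of 0 0] phi_left_le[of 0 0] rho lam
  by (simp add: delta_fun_left_eq delta_fun_eq mult_le_0_iff)

lemma a_range: "a \<in> {a_fun_right lam d delta rho alpha..a_fun lam d delta rho alpha}"
  using phi_right_ge[of alpha a] phi_left_le[of alpha a] rho
  by (simp add: a_fun_right_eq a_fun_eq)

lemma alpha_range: "alpha \<in> {0..1}"
proof -
  have "0 \<le> alpha"
  proof (rule ccontr)
    assume neg: "\<not> 0 \<le> alpha"
    \<comment> \<open>A negative address at or above \<open>alpha\<close> gives a point below
      \<open>0\<close> but at or above \<open>a\<close>.\<close>
    obtain n m where n: "N \<le> n"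
      and fl: "\<forall>c\<in>{0, alpha}. \<lfloor>real n * rho - of_int m - e - c\<rfloor> = \<lfloor>alpha - c\<rfloor>"
      using approx_right[of alpha 0] by auto
    have "\<lfloor>real n * rho - of_int m - e\<rfloor> < 0" "\<lfloor>real n * rho - of_int m - e - alpha\<rfloor> = 0"
      using fl neg by auto
    then have "real n * rho - of_int m - e < 0" "alpha \<le> real n * rho - of_int m - e"
      by linarith+
    then show False using zero_code[OF n, of m] a_code[OF n, of m] a by linarith
  qed
  moreover have "alpha \<le> 1"
  proof (rule ccontr)
    assume big: "\<not> alpha \<le> 1"
    obtain n m where n: "N \<le> n"
      \<comment> \<open>An address in \<open>[1, alpha)\<close> gives a point at or above
        \<open>1\<close> but below \<open>a\<close>.\<close>
      and fl: "\<forall>c\<in>{0, alpha}. \<lfloor>real n * rho - of_int m - e - c\<rfloor> = \<lceil>alpha - c\<rceil> - 1"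
      using approx_left[of alpha 0] by auto
    have "1 \<le> \<lfloor>real n * rho - of_int m - e\<rfloor>" "\<lfloor>real n * rho - of_int m - e - alpha\<rfloor> = - 1"
      using fl big by auto
    then have "1 \<le> real n * rho - of_int m - e" "real n * rho - of_int m - e < alpha"
      by linarith+
    then have "1 \<le> (T ^^ n) (- of_int m)" "(T ^^ n) (- of_int m) < a"
      using zero_code[OF n, of "m + 1"] a_code[OF n, of m] unfolding iter_neg_int by auto
    then show False using a by linarith
  qed
  ultimately show ?thesis by simp
qed

section \<open>The position of \<open>alpha\<close> relative to \<open>1 - rho\<close>\<close>

lemma alpha_gt_witness:
  assumes "1 - rho < alpha"
  obtains z where "z < a" "1 \<le> T z"
proof -
  \<comment> \<open>Address \<open>0\<close>, approached from the right, has its predecessor near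
    \<open>- rho\<close>. Raised by one, this lies left of \<open>alpha\<close>, so the point lies
    left of \<open>a\<close> while its image is at least \<open>1\<close>.\<close>
  obtain n m where n: "N + 1 \<le> n" and fl: "\<forall>k\<le>1. \<forall>c\<in>{0, alpha}.
      \<lfloor>real n * rho - of_int m - e - real k * rho - c\<rfloor> = \<lfloor>0 - real k * rho - c\<rfloor>"
    using approx_right[of 0 1] by auto
  define z where "z = (T ^^ (n - 1)) (- of_int m) + of_int 1"
  have key: "real (n - 1) * rho - of_int m - e = real n * rho - of_int m - e - real 1 * rho"
    using n by (simp add: of_nat_diff left_diff_distrib)
  have "\<lfloor>(T ^^ (n - 1)) (- of_int m) - a\<rfloor> = \<lfloor>0 - real 1 * rho - alpha\<rfloor>"
    using floor_code[of "n - 1" alpha a m] fl[rule_format, of 1 alpha] n unfolding key by simp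
  also have "\<dots> < - 1" using assms by linarith
  finally have "z < a" unfolding z_def by linarith
  moreover have "(T ^^ n) (- of_int m) = T ((T ^^ (n - 1)) (- of_int m))"
    using n by (cases n) auto
  moreover have "\<lfloor>(T ^^ n) (- of_int m) - 0\<rfloor> = \<lfloor>0 - real 0 * rho - 0\<rfloor>"
    using floor_code[of n 0 0 m] fl[rule_format, of 0 0] n by simp
  then have "0 \<le> (T ^^ n) (- of_int m)" by simp linarith
  ultimately show ?thesis using that[of z] unfolding z_def T_shift by simp
qed

lemma alpha_less_witness:
  assumes "alpha < 1 - rho"
  obtains z where "a \<le> z" "T z < 1"
proof -
  \<comment> \<open>The mirror image, with address \<open>0\<close> approached from the
    left.\<close>
  obtain n m where n: "N + 1 \<le> n" and fl: "\<forall>k\<le>1. \<forall>c\<in>{0, alpha}.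
      \<lfloor>real n * rho - of_int m - e - real k * rho - c\<rfloor> = \<lceil>0 - real k * rho - c\<rceil> - 1"
    using approx_left[of 0 1] by auto
  define z where "z = (T ^^ (n - 1)) (- of_int m) + of_int 1"
  have key: "real (n - 1) * rho - of_int m - e = real n * rho - of_int m - e - real 1 * rho"
    using n by (simp add: of_nat_diff left_diff_distrib)
  have "- 1 \<le> \<lceil>0 - real 1 * rho - alpha\<rceil> - 1" using assms by linarith
  also have "\<dots> = \<lfloor>(T ^^ (n - 1)) (- of_int m) - a\<rfloor>"
    using floor_code[of "n - 1" alpha a m] fl[rule_format, of 1 alpha] n unfolding key by simp
  finally have "a \<le> z" unfolding z_def by linarith
  moreover have "(T ^^ n) (- of_int m) = T ((T ^^ (n - 1)) (- of_int m))"
    using n by (cases n) auto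
  moreover have "\<lfloor>(T ^^ n) (- of_int m) - 0\<rfloor> = \<lceil>0 - real 0 * rho - 0\<rceil> - 1"
    using floor_code[of n 0 0 m] fl[rule_format, of 0 0] n by simp
  then have "(T ^^ n) (- of_int m) < 0" by simp linarith
  ultimately show ?thesis using that[of z] unfolding z_def T_shift by simp
qed

text \<open>Negative points map below \<open>1\<close>, so \<open>z\<close> lies in
  \<open>[0, a)\<close>, where \<open>T\<close> stays below \<open>lam * a + delta\<close>. The
  conclusion means \<open>eta2 lam delta < a\<close>.\<close>

lemma T_less_a:
  assumes "z < a" "1 \<le> T z" shows "1 < lam * a + delta"
proof -
  have "0 \<le> z"
  proof (rule ccontr)
    assume "\<not> 0 \<le> z"
    then have "\<lfloor>z\<rfloor> \<le> - 1" by linarith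
    then have "real_of_int \<lfloor>z\<rfloor> \<le> - 1" by linarith
    from mult_left_mono[OF this, of "1 - lam"]
    have "(1 - lam) * of_int \<lfloor>z\<rfloor> \<le> lam - 1" using lam by simp
    moreover have "lam * z < 0" using lam \<open>\<not> 0 \<le> z\<close> by (simp add: mult_pos_neg)
    moreover have "d * theta a (frac z) \<le> d" using d by (simp add: theta_def)
    moreover have "T z = lam * z + delta + (1 - lam) * of_int \<lfloor>z\<rfloor> + d * theta a (frac z)"
      by (simp add: F_def)
    ultimately have "T z < 1" using delta(2) d(2) by linarith
    with assms show False by simp
  qed
  then have "\<lfloor>z\<rfloor> = 0" using assms a by (intro floor_unique) auto
  then have "T z = lam * z + delta" using assms by (simp add: F_def theta_def frac_def)
  moreover have "lam * z < lam * a" using assms lam by simp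
  ultimately show ?thesis using assms by linarith
qed

text \<open>Monotonicity gives \<open>T a < 1\<close>, impossible for \<open>a = 1\<close>. The
  second conclusion means \<open>a < eta1 lam d delta\<close>.\<close>

lemma T_ge_a:
  assumes "a \<le> z" "T z < 1" shows "a < 1" "lam * a + delta + d < 1"
proof -
  have Ta: "T a < 1"
    using strict_mono_less_eq[OF T_strict_mono, of a z] assms by linarith
  show "a < 1"
  proof (rule ccontr)
    assume "\<not> a < 1"
    then have "a = 1" using a by simp
    then show False using Ta delta d lam by (simp add: F_def theta_def)
  qed
  then have "\<lfloor>a\<rfloor> = 0" using a by (intro floor_unique) auto
  then show "lam * a + delta + d < 1" using Ta by (simp add: F_def theta_def frac_def)
qed

lemma alpha_M1: "(delta, a) \<in> M1 lam d \<Longrightarrow> alpha \<le> 1 - rho"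
proof (rule ccontr)
  assume M: "(delta, a) \<in> M1 lam d" and "\<not> alpha \<le> 1 - rho"
  then obtain z where "z < a" "1 \<le> T z" using alpha_gt_witness by force
  then have "1 < lam * a + delta" by (rule T_less_a)
  moreover have "lam * a < 1 - delta - d" using M lam by (simp add: M1_def eta1_def field_simps)
  ultimately show False using d by linarith
qed

lemma alpha_M3: "(delta, a) \<in> M3 lam \<Longrightarrow> 1 - rho \<le> alpha"
proof (rule ccontr)
  assume M: "(delta, a) \<in> M3 lam" and "\<not> 1 - rho \<le> alpha"
  then obtain z where "a \<le> z" "T z < 1" using alpha_less_witness by force
  then have "lam * a + delta + d < 1" by (rule T_ge_a)
  moreover have "1 - delta < lam * a" using M lam by (simp add: M3_def eta2_def field_simps)
  ultimately show False using d by linarith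
qed

text \<open>\<open>1 - rho < alpha\<close> pushes \<open>a\<close> above \<open>eta2\<close>, and
  \<open>alpha < 1 - rho\<close> pushes it below \<open>eta1\<close>; \<open>M2\<close> excludes
  both.\<close>

lemma alpha_M2: "(delta, a) \<in> M2 lam d \<Longrightarrow> alpha = 1 - rho"
proof (rule ccontr)
  assume M: "(delta, a) \<in> M2 lam d" and "alpha \<noteq> 1 - rho"
  have *: "1 - delta - d \<le> lam * a" "lam * a \<le> 1 - delta"
    using M lam by (simp_all add: M2_def eta1_def eta2_def field_simps)
  consider "1 - rho < alpha" | "alpha < 1 - rho" using \<open>alpha \<noteq> 1 - rho\<close> by linarith
  then show False
  proof cases
    case 1
    then obtain z where "z < a" "1 \<le> T z" by (rule alpha_gt_witness)
    then have "1 < lam * a + delta" by (rule T_less_a)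
    with * show False by linarith
  next
    case 2
    then obtain z where "a \<le> z" "T z < 1" by (rule alpha_less_witness)
    then have "lam * a + delta + d < 1" by (rule T_ge_a)
    with * show False by linarith
  qed
qed

end

section \<open>Existence of codings\<close>

lemma floor_right_limit_shift: "\<forall>\<^sub>F t in at_right y. \<lfloor>t - s\<rfloor> = \<lfloor>y - s :: real\<rfloor>"
proof -
  have "filterlim (\<lambda>t. t - s) (at_right (y - s)) (at_right y)"
    unfolding filterlim_at
    by (intro conjI tendsto_intros) (simp add: eventually_at_filter)
  from eventually_compose_filterlim[OF floor_right_limit this] show ?thesis .
qed

lemma floor_left_limit_shift: "\<forall>\<^sub>F t in at_left y. \<lfloor>t - s\<rfloor> = \<lceil>y - s :: real\<rceil> - 1"
proof -
  have "filterlim (\<lambda>t. t - s) (at_left (y - s)) (at_left y)"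
    unfolding filterlim_at
    by (intro conjI tendsto_intros) (simp add: eventually_at_filter)
  from eventually_compose_filterlim[OF floor_left_limit this] show ?thesis .
qed

text \<open>On the grid of multiples of \<open>1 / q\<close>, the preceding grid point already
  realizes the left limit of the floor.\<close>

lemma floor_pred_divide:
  assumes "0 < q" shows "\<lfloor>of_int (j - 1) / real q\<rfloor> = \<lceil>of_int j / real q\<rceil> - 1"
proof (rule floor_unique)
  let ?l = "\<lceil>of_int j / real q\<rceil>"
  have "of_int (?l - 1) < of_int j / real q" by linarith
  then have "real_of_int ((?l - 1) * int q) < of_int j" using assms by (simp add: field_simps)
  then have "(?l - 1) * int q \<le> j - 1" by linarith
  then have "real_of_int ((?l - 1) * int q) \<le> of_int (j - 1)" by (simp only: of_int_le_iff)
  then show "of_int (?l - 1) \<le> of_int (j - 1) / real q" using assms by (simp add: field_simps)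
  have "of_int j / real q \<le> of_int ?l" by linarith
  from pos_divide_le_eq[THEN iffD1, OF _ this] assms have "of_int j \<le> of_int ?l * real q" by simp
  then have "of_int (j - 1) / real q < of_int ?l" using assms by (simp add: pos_divide_less_eq)
  then show "of_int (j - 1) / real q < of_int (?l - 1) + 1" by simp
qed

lemma rotation_orbit_dense:
  fixes rho :: real
  assumes "rho \<notin> \<rat>" "y < z"
  obtains n m where "M \<le> n" "y < real n * rho - of_int m" "real n * rho - of_int m < z"
proof -
  have "0 < (z - y) / 2" using assms by simp
  \<comment> \<open>Moving the target by \<open>- real M * rho\<close> allows \<open>M\<close> to be
    added to the time afterwards.\<close>
  from sequence_of_fractional_parts_is_dense[OF assms(1) this, of "(y + z) / 2 - real M * rho"]
  obtain h k where k: "k > 0" "\<bar>of_int k * rho - of_int h - ((y + z) / 2 - real M * rho)\<bar> < (z - y) / 2"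
    by blast
  have key: "real (M + nat k) * rho = of_int k * rho + real M * rho"
    using k(1) by (simp add: algebra_simps)
  have "y < real (M + nat k) * rho - of_int h" "real (M + nat k) * rho - of_int h < z"
    using k(2) unfolding key abs_less_iff by (simp_all add: field_simps)
  then show ?thesis using that by (meson le_add1)
qed

section \<open>Codings for irrational and for rational \<open>rho\<close>\<close>

context contracted_rotation_number
begin

lemma iter_gt_int: "of_int p < real n * rho - of_int m \<Longrightarrow> of_int p < (T ^^ n) (- of_int m)"
  using int_less_iter[of "p + m" n] unfolding iter_neg_int by simp

lemma iter_neg: "real n * rho - of_int m < 0 \<Longrightarrow> (T ^^ n) (- of_int m) < 0"
  using iter_less_int[of n m] unfolding iter_neg_int by simp

text \<open>By \<open>iter_order\<close> the addresses of points left of \<open>a\<close> form an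
  initial segment of all addresses up to its supremum \<open>alpha\<close>; density provides the
  approximations, with \<open>e = 0\<close>.\<close>

lemma irrational_coding:
  assumes irr: "rho \<notin> \<rat>"
  shows "\<exists>alpha N. rotation_coding lam d delta a rho 0 alpha N"
proof -
  define S where "S = {real n * rho - of_int m | n m. (T ^^ n) (- of_int m) < a}"
  define alpha where "alpha = Sup S"
  have ne: "S \<noteq> {}"
  proof -
    have "(T ^^ 0) (- of_int 1) < a" using a by simp
    then show ?thesis unfolding S_def by blast
  qed
  have bdd: "bdd_above S"
  proof (rule bdd_aboveI)
    fix s assume "s \<in> S"
    then obtain n m where "s = real n * rho - of_int m" "(T ^^ n) (- of_int m) < a"
      unfolding S_def by blast
    then show "s \<le> 1" using iter_gt_int[of 1 n m] a by fastforce
  qed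
  have unique: "n = n'" if "real n * rho - of_int m = real n' * rho - of_int m'" for n n' m m'
  proof (rule ccontr)
    assume "n \<noteq> n'"
    then have "rho = of_int (m - m') / of_int (int n - int n')"
      using that by (simp add: field_simps)
    with irr show False by (metis Rats_divide Rats_of_int)
  qed
  \<comment> \<open>At most one time yields the address \<open>alpha\<close>, where the cut decides
    nothing; \<open>N0\<close> lies beyond it.\<close>
  obtain N0 where N0: "\<And>n m. N0 \<le> n \<Longrightarrow> real n * rho - of_int m \<noteq> alpha"
  proof (cases "\<exists>n m. real n * rho - of_int m = alpha")
    case True
    then obtain n0 m0 where "real n0 * rho - of_int m0 = alpha" by blast
    then show ?thesis using unique that[of "Suc n0"] by (metis not_less_eq_eq order_refl)
  qed (use that in blast)
  have less_alpha: "(T ^^ n) (- of_int m) < a" if less: "real n * rho - of_int m < alpha" for n m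
  proof -
    obtain s where "s \<in> S" "real n * rho - of_int m < s"
      using less less_cSup_iff[OF ne bdd] unfolding alpha_def by blast
    then obtain n' m' where "(T ^^ n') (- of_int m') < a"
      "real n * rho - of_int m < real n' * rho - of_int m'" unfolding S_def by blast
    then show ?thesis using iter_order by (meson order_less_trans)
  qed
  have gr_alpha: "a \<le> (T ^^ n) (- of_int m)" if "alpha < real n * rho - of_int m" for n m
  proof (rule ccontr)
    assume "\<not> a \<le> (T ^^ n) (- of_int m)"
    then have "real n * rho - of_int m \<in> S" unfolding S_def by force
    then have "real n * rho - of_int m \<le> alpha" unfolding alpha_def using bdd by (rule cSup_upper)
    with that show False by simp
  qed
  have "rotation_coding lam d delta a rho 0 alpha (max 1 N0)"
  proof unfold_locales
    fix n and m :: int assume n: "max 1 N0 \<le> n"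
    \<comment> \<open>Address \<open>0\<close> occurs only at time \<open>0\<close>, excluded by
      \<open>max 1 N0\<close>.\<close>
    have "real n * rho - of_int m \<noteq> 0" using unique[of n m 0 0] n by auto
    then consider "of_int 0 < real n * rho - of_int m" | "real n * rho - of_int m < 0" by fastforce
    then show "0 \<le> (T ^^ n) (- of_int m) \<longleftrightarrow> 0 \<le> real n * rho - of_int m - 0"
      by cases (use iter_gt_int[of 0 n m] iter_neg[of n m] in auto)
    show "a \<le> (T ^^ n) (- of_int m) \<longleftrightarrow> alpha \<le> real n * rho - of_int m - 0"
      using N0[of n m] n less_alpha[of n m] gr_alpha[of n m] by force
  next
    fix y K
    \<comment> \<open>Finitely many floors are constant together on an interval right of
      \<open>y\<close>, and density puts a late address there.\<close>
    have "\<forall>\<^sub>F t in at_right y. \<forall>k\<in>{..K}. \<forall>c\<in>{0, alpha}.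
        \<lfloor>t - (real k * rho + c)\<rfloor> = \<lfloor>y - (real k * rho + c)\<rfloor>"
      by (intro eventually_ball_finite ballI floor_right_limit_shift) auto
    then obtain b where b: "b > y" "\<And>t. y < t \<Longrightarrow> t < b \<Longrightarrow> \<forall>k\<in>{..K}. \<forall>c\<in>{0, alpha}.
        \<lfloor>t - (real k * rho + c)\<rfloor> = \<lfloor>y - (real k * rho + c)\<rfloor>"
      unfolding eventually_at_right_field by blast
    obtain n m where nm: "max 1 N0 + K \<le> n" "y < real n * rho - of_int m" "real n * rho - of_int m < b"
      using rotation_orbit_dense[OF irr b(1)] .
    then show "\<exists>n m. max 1 N0 + K \<le> n \<and> (\<forall>k\<le>K. \<forall>c\<in>{0, alpha}.
        \<lfloor>real n * rho - of_int m - 0 - real k * rho - c\<rfloor> = \<lfloor>y - real k * rho - c\<rfloor>)"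
      using b(2)[OF nm(2,3)] by (intro exI[of _ n] exI[of _ m]) (simp add: diff_diff_eq add.assoc)
    have "\<forall>\<^sub>F t in at_left y. \<forall>k\<in>{..K}. \<forall>c\<in>{0, alpha}.
        \<lfloor>t - (real k * rho + c)\<rfloor> = \<lceil>y - (real k * rho + c)\<rceil> - 1"
      by (intro eventually_ball_finite ballI floor_left_limit_shift) auto
    then obtain b where b: "b < y" "\<And>t. b < t \<Longrightarrow> t < y \<Longrightarrow> \<forall>k\<in>{..K}. \<forall>c\<in>{0, alpha}.
        \<lfloor>t - (real k * rho + c)\<rfloor> = \<lceil>y - (real k * rho + c)\<rceil> - 1"
      unfolding eventually_at_left_field by blast
    obtain n m where nm: "max 1 N0 + K \<le> n" "b < real n * rho - of_int m" "real n * rho - of_int m < y"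
      using rotation_orbit_dense[OF irr b(1)] .
    then show "\<exists>n m. max 1 N0 + K \<le> n \<and> (\<forall>k\<le>K. \<forall>c\<in>{0, alpha}.
        \<lfloor>real n * rho - of_int m - 0 - real k * rho - c\<rfloor> = \<lceil>y - real k * rho - c\<rceil> - 1)"
      using b(2)[OF nm(2,3)] by (intro exI[of _ n] exI[of _ m]) (simp add: diff_diff_eq add.assoc)
  qed
  then show ?thesis by blast
qed

text \<open>Points with equal addresses are linked by returns \<open>T ^^ q\<close> translated by
  \<open>- p\<close>, hence move monotonically, and each address eventually settles on one side of
  \<open>a\<close>.\<close>

lemma rational_coding:
  assumes rat: "rho \<in> \<rat>"
  shows "\<exists>e alpha N. rotation_coding lam d delta a rho e alpha N"
proof -
  obtain p q :: nat where q: "q \<noteq> 0" and rho_pq: "\<bar>rho\<bar> = real p / real q" and cop: "coprime p q"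
    using rat by (rule Rats_abs_nat_div_natE)
  have rho_eq: "rho = real p / real q" using rho_pq rho by simp
  \<comment> \<open>\<open>up\<close> tells whether returns of \<open>0\<close> stay at or above
    \<open>0\<close>. If not, the shift \<open>e = 1\<close> makes their addresses negative.
    \<open>code\<close> is the address in units of \<open>1 / q\<close>.\<close>
  define up where "up \<longleftrightarrow> real p \<le> (T ^^ q) 0"
  define e :: int where "e = (if up then 0 else 1)"
  define code where "code n m = int (n * p) - m * int q - e" for n m
  have key: "real n * rho - of_int m - of_int e / real q = of_int (code n m) / real q" for n m
    using q by (simp add: rho_eq code_def field_simps)
  have code_le: "of_int i / real q \<le> real n * rho - of_int m - of_int e / real q \<longleftrightarrow> i \<le> code n m"
    for i n m unfolding key using q by (simp add: divide_le_cancel)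
  have order: "(T ^^ n) (- of_int m) < (T ^^ n') (- of_int m')" if "code n m < code n' m'" for n m n' m'
  proof (rule iter_order)
    have "real_of_int (code n m) / real q < of_int (code n' m') / real q"
      using that q by (simp add: divide_strict_right_mono)
    then show "real n * rho - of_int m < real n' * rho - of_int m'" unfolding key[symmetric] by simp
  qed
  \<comment> \<open>An inverse of \<open>p\<close> modulo \<open>q\<close> gives the residue of the
    time; adding \<open>M * q\<close> makes the time late.\<close>
  have attained: "\<exists>n m. M \<le> n \<and> code n m = i" for M i
  proof -
    have "coprime (int p) (int q)" using cop by simp
    then obtain x where x: "[int p * x = 1] (mod int q)" using cong_solve_coprime_int by blast
    define n where "n = nat ((i + e) * x mod int q) + M * q"
    have "int n = (i + e) * x mod int q + int M * int q" using q by (simp add: n_def)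
    then have "[int n = (i + e) * x] (mod int q)" by (simp add: cong_def)
    then have "[int n * int p = (i + e) * x * int p] (mod int q)" by (rule cong_scalar_right)
    also have "[(i + e) * x * int p = (i + e) * 1] (mod int q)"
      using cong_scalar_left[OF x, of "i + e"] by (simp add: mult_ac)
    finally have "int q dvd int n * int p - (i + e)" by (simp add: cong_iff_dvd_diff)
    then obtain m where "int n * int p - (i + e) = int q * m" by (rule dvdE)
    then have "code n m = i" by (simp add: code_def algebra_simps)
    moreover have "M \<le> n"
    proof -
      have "M * 1 \<le> M * q" using q by (intro mult_le_mono2) simp
      then show ?thesis unfolding n_def by linarith
    qed
    ultimately show ?thesis by blast
  qed
  have period: "\<exists>j. n' = n + j * q \<and> m' = m + int j * int p" if "code n m = code n' m'" "n \<le> n'" for n m n' m'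
  proof -
    obtain l where l: "n' = n + l" using \<open>n \<le> n'\<close> le_Suc_ex by blast
    have *: "int l * int p = (m' - m) * int q" using that(1) l by (simp add: code_def algebra_simps)
    then have "int q dvd int (l * p)" by (metis dvd_triv_right of_nat_mult)
    then have "q dvd l" using cop by (simp add: coprime_commute coprime_dvd_mult_left_iff)
    then obtain j where j: "l = q * j" by (rule dvdE)
    then have "int q * (int j * int p) = int q * (m' - m)" using * by (simp add: mult_ac)
    then have "m' - m = int j * int p" using q by simp
    then show ?thesis using l j by (intro exI[of _ j]) (simp add: mult.commute)
  qed
  have split: "(T ^^ (n + j * q)) (- of_int (m + int j * int p))
      = (T ^^ n) ((T ^^ (j * q)) 0 - of_int (int j * int p) + - of_int m)" for n j m
  proof -
    have "(T ^^ (j * q)) (- of_int (m + int j * int p)) = (T ^^ (j * q)) 0 - of_int (int j * int p) + - of_int m"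
      unfolding iter_neg_int by simp
    then show ?thesis by (simp only: funpow_add comp_apply)
  qed
  have up_mono: "(T ^^ n) (- of_int m) \<le> (T ^^ n') (- of_int m')"
    if "up" "code n m = code n' m'" "n \<le> n'" for n m n' m'
  proof -
    from period[OF that(2,3)] obtain j where j: "n' = n + j * q" "m' = m + int j * int p" by blast
    have "of_int (int j * int p) \<le> (T ^^ (j * q)) 0"
      using \<open>up\<close> by (intro iter_mult_ge) (simp add: up_def)
    then show ?thesis unfolding j split iter_le_iff by simp
  qed
  have down_mono: "(T ^^ n') (- of_int m') \<le> (T ^^ n) (- of_int m)"
    if "\<not> up" "code n m = code n' m'" "n \<le> n'" for n m n' m'
  proof -
    from period[OF that(2,3)] obtain j where j: "n' = n + j * q" "m' = m + int j * int p" by blast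
    have "(T ^^ (j * q)) 0 \<le> of_int (int j * int p)"
      using \<open>\<not> up\<close> by (intro iter_mult_le) (simp add: up_def)
    then show ?thesis unfolding j split iter_le_iff by simp
  qed
  \<comment> \<open>Time \<open>0\<close> is excluded because, when \<open>up\<close> fails, the
    point \<open>0\<close> itself has code \<open>- 1\<close>.\<close>
  have zero: "0 \<le> (T ^^ n) (- of_int m) \<longleftrightarrow> 0 \<le> code n m" if n: "1 \<le> n" for n m
  proof (cases up)
    case True
    then have c00: "code 0 0 = 0" by (simp add: code_def e_def)
    show ?thesis
      using order[of n m 0 0] order[of 0 0 n m] up_mono[OF True, of 0 0 n m] unfolding c00
      by (cases "code n m" "0 :: int" rule: linorder_cases) auto
  next
    case False
    then have c00: "code 0 0 = - 1" by (simp add: code_def e_def)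
    show ?thesis
    proof (cases "code n m" "- 1 :: int" rule: linorder_cases)
      case less
      then show ?thesis using order[of n m 0 0] c00 by simp
    next
      case greater
      then show ?thesis using order[of 0 0 n m] c00 by simp
    next
      case equal
      obtain j where j: "n = j * q" "m = int j * int p"
        using period[of 0 0 n m] equal c00 by auto
      then obtain i where i: "j = Suc i" using n by (cases j) auto
      \<comment> \<open>Returns descend, so all lie at or below the first one, which is
        negative.\<close>
      have "(T ^^ n) (- of_int m) \<le> (T ^^ q) (- of_int (int p))"
        using down_mono[OF False, of q "int p" n m] equal c00 False
        by (simp add: j i code_def e_def algebra_simps)
      also have "\<dots> < 0" unfolding iter_neg_int using False by (simp add: up_def)
      finally show ?thesis using equal by simp
    qed
  qed
  define I where "I = {i. \<exists>N. \<forall>n\<ge>N. \<forall>m. code n m = i \<longrightarrow> a \<le> (T ^^ n) (- of_int m)}"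
  \<comment> \<open>Monotone motion makes the alternative to \<open>I\<close> eventual as well:
    rising points then never reach \<open>a\<close>, and falling points stay below \<open>a\<close>
    once there.\<close>
  have not_I: "\<exists>N. \<forall>n\<ge>N. \<forall>m. code n m = i \<longrightarrow> (T ^^ n) (- of_int m) < a" if i: "i \<notin> I" for i
  proof -
    obtain n0 m0 where nm0: "code n0 m0 = i" "(T ^^ n0) (- of_int m0) < a"
      using i unfolding I_def by force
    show ?thesis
    proof (cases up)
      case True
      have "(T ^^ n) (- of_int m) < a" if "code n m = i" for n m
      proof (rule ccontr)
        assume "\<not> (T ^^ n) (- of_int m) < a"
        then have "\<forall>n'\<ge>n. \<forall>m'. code n' m' = i \<longrightarrow> a \<le> (T ^^ n') (- of_int m')"
          using up_mono[OF True, of n m] that by (metis linorder_not_less order_trans)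
        with i show False unfolding I_def by blast
      qed
      then show ?thesis by blast
    next
      case False
      then have "\<forall>n\<ge>n0. \<forall>m. code n m = i \<longrightarrow> (T ^^ n) (- of_int m) < a"
        using down_mono[OF False, of n0 m0] nm0 by (metis order_le_less_trans)
      then show ?thesis by blast
    qed
  qed
  have "int q \<in> I"
  proof -
    have "a \<le> (T ^^ n) (- of_int m)" if "1 \<le> n" "code n m = int q" for n m
    proof -
      have "code n (m + 1) = 0" using that by (simp add: code_def algebra_simps)
      then have "0 \<le> (T ^^ n) (- of_int (m + 1))" using zero[OF \<open>1 \<le> n\<close>, of "m + 1"] by auto
      then show ?thesis using a unfolding iter_neg_int by simp
    qed
    then show ?thesis unfolding I_def by blast
  qed
  \<comment> \<open>The least nonnegative member of \<open>I\<close>. Code \<open>- 1\<close> is not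
    in \<open>I\<close>, since late points with it are below \<open>0\<close>, so
    \<open>i0 - 1\<close> lies outside \<open>I\<close> even when \<open>i0 = 0\<close>.\<close>
  define i0 where "i0 = int (LEAST i. int i \<in> I)"
  have i0: "i0 \<in> I" unfolding i0_def using \<open>int q \<in> I\<close> by (rule LeastI)
  have "i0 - 1 \<notin> I"
  proof (cases "i0 = 0")
    case True
    have "- 1 \<notin> I"
    proof
      assume "- 1 \<in> I"
      then obtain M where M: "\<forall>n\<ge>M. \<forall>m. code n m = - 1 \<longrightarrow> a \<le> (T ^^ n) (- of_int m)"
        unfolding I_def by blast
      obtain n m where "max 1 M \<le> n" "code n m = - 1" using attained by blast
      then show False using M[rule_format, of n m] zero[of n m] a by simp
    qed
    with True show ?thesis by simp
  next
    case False
    then obtain i where i: "i0 = int (Suc i)" unfolding i0_def by (metis int_eq_iff_numeral not0_implies_Suc of_nat_0)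
    then have "i < (LEAST i. int i \<in> I)" unfolding i0_def by simp
    then have "int i \<notin> I" by (rule not_less_Least)
    with i show ?thesis by simp
  qed
  from not_I[OF this] i0 obtain N1 N2 where
    N1: "\<And>n m. N1 \<le> n \<Longrightarrow> code n m = i0 - 1 \<Longrightarrow> (T ^^ n) (- of_int m) < a" and
    N2: "\<And>n m. N2 \<le> n \<Longrightarrow> code n m = i0 \<Longrightarrow> a \<le> (T ^^ n) (- of_int m)"
    unfolding I_def by blast
  define N where "N = max 1 (max N1 N2)"
  define alpha where "alpha = of_int i0 / real q"
  have "rotation_coding lam d delta a rho (of_int e / real q) alpha N"
  proof unfold_locales
    fix n and m :: int assume n: "N \<le> n"
    show "0 \<le> (T ^^ n) (- of_int m) \<longleftrightarrow> 0 \<le> real n * rho - of_int m - of_int e / real q"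
      using zero[of n m] code_le[of 0 n m] n by (simp add: N_def)
    \<comment> \<open>Codes above \<open>i0\<close> or below \<open>i0 - 1\<close> are compared by
      \<open>order\<close> with one late point, so a single \<open>N\<close> serves all
      codes.\<close>
    have "a \<le> (T ^^ n) (- of_int m) \<longleftrightarrow> i0 \<le> code n m"
    proof (cases "i0 \<le> code n m")
      case True
      obtain n' m' where n': "N \<le> n'" "code n' m' = i0" using attained by blast
      have "a \<le> (T ^^ n') (- of_int m')" using N2[of n' m'] n' by (simp add: N_def)
      then have "a \<le> (T ^^ n) (- of_int m)"
        using True order[of n' m' n m] n' N2[of n m] n by (cases "code n m = i0") (auto simp: N_def)
      with True show ?thesis by simp
    next
      case False
      obtain n' m' where n': "N \<le> n'" "code n' m' = i0 - 1" using attained by blast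
      have "(T ^^ n') (- of_int m') < a" using N1[of n' m'] n' by (simp add: N_def)
      then have "(T ^^ n) (- of_int m) < a"
        using False order[of n m n' m'] n' N1[of n m] n by (cases "code n m = i0 - 1") (auto simp: N_def)
      with False show ?thesis by simp
    qed
    then show "a \<le> (T ^^ n) (- of_int m) \<longleftrightarrow> alpha \<le> real n * rho - of_int m - of_int e / real q"
      unfolding alpha_def code_le .
  next
    fix y K assume "y \<in> {0, alpha}"
    then obtain i where y: "y = of_int i / real q" unfolding alpha_def
      by (metis div_0 empty_iff insert_iff of_int_0)
    \<comment> \<open>The grid point \<open>i\<close> itself serves for the right side, its
      predecessor \<open>i - 1\<close> for the left.\<close>
    obtain n m where nm: "N + K \<le> n" "code n m = i" using attained by blast
    then show "\<exists>n m. N + K \<le> n \<and> (\<forall>k\<le>K. \<forall>c\<in>{0, alpha}.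
        \<lfloor>real n * rho - of_int m - of_int e / real q - real k * rho - c\<rfloor> = \<lfloor>y - real k * rho - c\<rfloor>)"
      unfolding key y by blast
    obtain n m where nm: "N + K \<le> n" "code n m = i - 1" using attained by blast
    have "\<lfloor>real n * rho - of_int m - of_int e / real q - real k * rho - c\<rfloor> = \<lceil>y - real k * rho - c\<rceil> - 1"
      if "c \<in> {0, alpha}" for k c
    proof -
      obtain l where c: "c = of_int l / real q" using \<open>c \<in> {0, alpha}\<close> unfolding alpha_def
        by (metis div_0 empty_iff insert_iff of_int_0)
      have "y - real k * rho - c = of_int (i - int (k * p) - l) / real q"
        by (simp add: y c rho_eq diff_divide_distrib)
      moreover have "real n * rho - of_int m - of_int e / real q - real k * rho - c
          = of_int (i - int (k * p) - l - 1) / real q"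
        unfolding key nm(2) by (simp add: c rho_eq diff_divide_distrib)
      ultimately show ?thesis using floor_pred_divide q by (simp only: neq0_conv)
    qed
    with nm(1) show "\<exists>n m. N + K \<le> n \<and> (\<forall>k\<le>K. \<forall>c\<in>{0, alpha}.
        \<lfloor>real n * rho - of_int m - of_int e / real q - real k * rho - c\<rfloor> = \<lceil>y - real k * rho - c\<rceil> - 1)"
      by blast
  qed
  then show ?thesis by blast
qed

lemma coding_exists: "\<exists>e alpha N. rotation_coding lam d delta a rho e alpha N"
  using irrational_coding rational_coding by blast

end

section \<open>Assembly for the rotation number of \<open>f\<close>\<close>

theorem theorem2p6:
  fixes lam d delta a :: real
  assumes "lam \<in> {0<..<1}"
    and "d \<in> {0<..<1 - lam}"
    and "delta \<in> {1 - lam - d<..<1}"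
    and "a \<in> {0..1}"
    and "(delta, a) \<notin> F1 lam d \<union> F2 lam d"
  shows "(\<exists>rho \<in> {0<..<1}. \<exists>alpha \<in> {0..1}.
            delta \<in> {delta_fun_left lam d rho alpha..delta_fun lam d rho alpha} \<and>
            a \<in> {a_fun_right lam d delta rho alpha..a_fun lam d delta rho alpha}) \<and>
         (\<forall>rho_f \<in> {0<..<1}. rho_f = rotation_number lam d delta a \<longrightarrow>
           (\<exists>alpha \<in> {0..1}.
              delta \<in> {delta_fun_left lam d rho_f alpha..delta_fun lam d rho_f alpha} \<and>
              a \<in> {a_fun_right lam d delta rho_f alpha..a_fun lam d delta rho_f alpha} \<and>
              ((delta, a) \<in> M1 lam d \<longrightarrow> alpha \<in> {0..1 - rho_f}) \<and>
              ((delta, a) \<in> M3 lam \<longrightarrow> alpha \<in> {1 - rho_f..1}) \<and>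
              ((delta, a) \<in> M2 lam d \<and> (rho_f \<notin> \<rat> \<or> a \<notin> {eta1 lam d delta, eta2 lam delta})
                 \<longrightarrow> alpha = 1 - rho_f)))"
proof -
  interpret contracted_rotation lam d delta a
    using assms by unfold_locales auto
  obtain L where L: "0 < L" "L < 1" "\<And>x. (\<lambda>n. (T ^^ n) x / real n) \<longlonglongrightarrow> L"
    "\<And>L'. \<forall>x. (\<lambda>n. (T ^^ n) x / real n) \<longlonglongrightarrow> L' \<Longrightarrow> L' = L"
    by (rule rotation_limit) blast
  have "(THE L. \<forall>x. (\<lambda>n. (T ^^ n) x / real n) \<longlonglongrightarrow> L) = L"
    using L(3,4) by (intro the_equality) blast+
  then have number: "rotation_number lam d delta a = L"
    using L(1,2) by (simp add: rotation_number_def frac_eq)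
  interpret contracted_rotation_number lam d delta a L
    using L by unfold_locales auto
  obtain e alpha N where "rotation_coding lam d delta a L e alpha N"
    using coding_exists by blast
  then interpret rotation_coding lam d delta a L e alpha N .
  \<comment> \<open>The limit \<open>L\<close> lies in \<open>(0, 1)\<close> and equals the rotation
    number, so it is the \<open>rho\<close> of the first claim, and one \<open>alpha\<close> serves
    both claims.\<close>
  show ?thesis
    unfolding number
    using L(1,2) alpha_range delta_range a_range alpha_M1 alpha_M2 alpha_M3
    by (intro conjI ballI impI bexI[of _ L] bexI[of _ alpha]) auto
qed

end
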